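(* Let $n\ge 0$ be an integer. If $n$ is even, then $$\Delta(B_{\bar 1}^{(n)})=\sum_{r=0}^{n}B_{\bar 1}^{(n-r)}\otimes\Big(\sum_{c=0}^{\lfloor r/2\rfloor}\sum_{a=0}^{r-2c}q^{\binom{2c+1}{2}+(r-2c)(r-n)-a(r-2c-a)}(q\varsigma)^c\,\check{E}^{(a)}\begin{bmatrix}h;-\lfloor\frac{r-1}{2}\rfloor\\ c\end{bmatrix}K^{r-n}F^{(r-2c-a)}\Big).$$ If $n$ is odd, then $$\Delta(B_{\bar 1}^{(n)})=\sum_{r=0}^{n}B_{\bar 1}^{(n-r)}\otimes\Big(\sum_{c=0}^{\lfloor r/2\rfloor}\sum_{a=0}^{r-2c}q^{\binom{2c}{2}+(r-2c)(r-n)-a(r-2c-a)}(q\varsigma)^c\,\check{E}^{(a)}\begin{bmatrix}h;-\lfloor\frac{r-2}{2}\rfloor\\ c\end{bmatrix}K^{r-n}F^{(r-2c-a)}\Big).$$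
   Context: The base field is $\mathbb{Q}(q)$, $q$ an indeterminate, and $\varsigma\in\mathbb{Q}(q)^\times$ is a fixed parameter. Quantum integers: $[n]=\frac{q^n-q^{-n}}{q-q^{-1}}$ for $n\in\mathbb{Z}$, $[n]!=[1][2]\cdots[n]$ (with $[0]!=1$). In exponents of $q$, $\binom{m}{2}=m(m-1)/2$ is the ordinary binomial coefficient. $\lfloor x\rfloor$ is the largest integer $\le x$ (e.g. $\lfloor -1/2\rfloor=-1$). $\mathbf{U}$ is the quantum group of $\mathfrak{sl}_2$ over $\mathbb{Q}(q)$ with generators $E,F,K^{\pm1}$ and relations $KE=q^2EK$, $KF=q^{-2}FK$, $EF-FE=\frac{K-K^{-1}}{q-q^{-1}}$. The comultiplication is the algebra homomorphism $\Delta:\mathbf{U}\to\mathbf{U}\otimes\mathbf{U}$ with $\Delta(E)=E\otimes1+K\otimes E$, $\Delta(F)=1\otimes F+F\otimes K^{-1}$, $\Delta(K)=K\otimes K$. Put $\check{E}=\varsigma EK^{-1}$, $B=F+\check{E}$, $\check{E}^{(a)}=\check{E}^a/[a]!$, $F^{(a)}=F^a/[a]!$, and for $a\in\mathbb{Z}$, $n\ge0$, $$\begin{bmatrix}h;a\\ n\end{bmatrix}=\prod_{i=1}^{n}\frac{q^{4a+4i-4}K^{-2}-1}{q^{4i}-1}\in\mathbf{U}$$ (equal to $1$ for $n=0$). The $\imath$-divided powers of parity $\bar 1$ are defined for $n\in\mathbb{N}=\{0,1,2,\dots\}$ by $$B_{\bar 1}^{(n)}=\frac{1}{[n]!}\begin{cases}B\prod_{j=1}^{k}(B^2-q\varsigma[2j-1]^2)&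 n=2k+1,\\ \prod_{j=1}^{k}(B^2-q\varsigma[2j-1]^2)& n=2k.\end{cases}$$ *)

theory Defs
  imports
    "HOL-Library.Poly_Mapping"
    "HOL-Computational_Algebra.Polynomial"
    "HOL-Computational_Algebra.Fraction_Field"
begin

type_synonym ratfun = "rat poly fract"

definition q :: ratfun where
  "q = Fraction_Field.Fract [:0, 1:] 1"

lemma q_nonzero: "q \<noteq> 0"
  by (simp add: q_def Zero_fract_def eq_fract)

definition qint :: "int \<Rightarrow> ratfun" where
  "qint n = (q powi n - q powi (- n)) / (q - q powi (- 1))"

definition qfact :: "nat \<Rightarrow> ratfun" where
  "qfact n = (\<Prod>i = 1..n. qint (int i))"

class qalgebra = ring_1 +
  fixes scaleq :: "ratfun \<Rightarrow> 'a \<Rightarrow> 'a"  (infixr \<open>*\<^sub>q\<close> 75)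
  assumes scaleq_add_right: "c *\<^sub>q (x + y) = c *\<^sub>q x + c *\<^sub>q y"
    and scaleq_add_left: "(c + d) *\<^sub>q x = c *\<^sub>q x + d *\<^sub>q x"
    and scaleq_scaleq: "c *\<^sub>q d *\<^sub>q x = (c * d) *\<^sub>q x"
    and scaleq_one: "1 *\<^sub>q x = x"
    and scaleq_mult_left: "(c *\<^sub>q x) * y = c *\<^sub>q (x * y)"
    and scaleq_mult_right: "x * (c *\<^sub>q y) = c *\<^sub>q (x * y)"
begin

lemma scaleq_zero_left: "0 *\<^sub>q x = 0"
  using scaleq_add_left[of 0 0 x] by simp

lemma scaleq_zero_right: "c *\<^sub>q 0 = 0"
  using scaleq_add_right[of c 0 0] by simp

lemma scaleq_minus_left: "(- c) *\<^sub>q x = - (c *\<^sub>q x)"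
  using scaleq_add_left[of "- c" c x] by (simp add: scaleq_zero_left eq_neg_iff_add_eq_0)

lemma scaleq_minus_right: "c *\<^sub>q (- x) = - (c *\<^sub>q x)"
  using scaleq_add_right[of c "- x" x] by (simp add: scaleq_zero_right eq_neg_iff_add_eq_0)

end

text \<open>
  For a monoid \<open>'m\<close>, written additively, the ring \<open>'m \<Rightarrow>\<^sub>0 ratfun\<close> is the
  monoid algebra; the scalar \<open>c\<close> is \<open>Poly_Mapping.single 0 c\<close>.
\<close>

abbreviation const :: "ratfun \<Rightarrow> ('m::monoid_add \<Rightarrow>\<^sub>0 ratfun)" where
  "const c \<equiv> Poly_Mapping.single 0 c"

lemma poly_mapping_single_induct [case_names zero single add]:
  fixes p :: "'m \<Rightarrow>\<^sub>0 'b::comm_monoid_add"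
  assumes "P 0" and "\<And>m c. P (Poly_Mapping.single m c)"
    and "\<And>x y. P x \<Longrightarrow> P y \<Longrightarrow> P (x + y)"
  shows "P p"
proof (induction p rule: Poly_Mapping.update_induct)
  case const
  then show ?case by (rule assms(1))
next
  case (update f a b)
  have "Poly_Mapping.update a b f = f + Poly_Mapping.single a b"
    by (rule poly_mapping_eqI)
      (use update in \<open>auto simp: Poly_Mapping.lookup_update lookup_add lookup_single in_keys_iff\<close>)
  then show ?case using update assms by simp
qed

lemma const_central: "const c * x = x * (const c :: 'm::monoid_add \<Rightarrow>\<^sub>0 ratfun)"
  by (induction x rule: poly_mapping_single_induct)
    (simp_all add: mult_single algebra_simps)

lemma const_mult_right: "x * (const c * y) = const c * (x * (y :: 'm::monoid_add \<Rightarrow>\<^sub>0 ratfun))"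
  by (metis const_central mult.assoc)

text \<open>The generator \<open>genKi\<close> stands for \<open>K\<^sup>-\<^sup>1\<close>.\<close>

datatype gen = genE | genF | genK | genKi

datatype word = Word (letters: "gen list")

instantiation word :: monoid_add
begin
definition "0 = Word []"
definition "v + w = Word (letters v @ letters w)"
instance by standard (simp_all add: zero_word_def plus_word_def)
end

type_synonym free_alg = "word \<Rightarrow>\<^sub>0 ratfun"

definition gen :: "gen \<Rightarrow> free_alg" where
  "gen g = Poly_Mapping.single (Word [g]) 1"

definition free_eval :: "(gen \<Rightarrow> 'a::qalgebra) \<Rightarrow> free_alg \<Rightarrow> 'a" where
  "free_eval f p =
    (\<Sum>w\<in>Poly_Mapping.keys p. Poly_Mapping.lookup p w *\<^sub>q prod_list (map f (letters w)))"

lemma free_eval_zero: "free_eval f 0 = 0"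
  by (simp add: free_eval_def)

lemma free_eval_single:
  "free_eval f (Poly_Mapping.single w c) = c *\<^sub>q prod_list (map f (letters w))"
  by (simp add: free_eval_def scaleq_zero_left)

lemma free_eval_add: "free_eval f (x + y) = free_eval f x + free_eval f y"
  unfolding free_eval_def
  by (rule setsum_keys_plus_distrib) (simp_all add: scaleq_zero_left scaleq_add_left)

lemma free_eval_mult: "free_eval f (x * y) = free_eval f x * free_eval f y"
proof (induction x rule: poly_mapping_single_induct)
  case (single v c)
  show ?case
  proof (induction y rule: poly_mapping_single_induct)
    case (single w d)
    show ?case
      by (simp add: mult_single free_eval_single plus_word_def scaleq_mult_left
          scaleq_mult_right scaleq_scaleq mult.assoc mult.commute[of d c])
  qed (simp_all add: free_eval_zero free_eval_add distrib_left)
qed (simp_all add: free_eval_zero free_eval_add distrib_right)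

lemma free_eval_diff: "free_eval f (x - y) = free_eval f x - free_eval f y"
  using free_eval_add[of f "x - y" y] by simp

lemma free_eval_gen: "free_eval f (gen g) = f g"
  by (simp add: gen_def free_eval_single scaleq_one)

lemma free_eval_const: "free_eval f (const c) = c *\<^sub>q 1"
  by (simp add: free_eval_single zero_word_def)

lemma free_eval_one: "free_eval f 1 = 1"
  using free_eval_const[of f 1] by (simp add: scaleq_one)

inductive_set uq_ideal :: "free_alg set" where
  rel_KKi: "gen genK * gen genKi - 1 \<in> uq_ideal"
| rel_KiK: "gen genKi * gen genK - 1 \<in> uq_ideal"
| rel_KE: "gen genK * gen genE - const (q powi 2) * gen genE * gen genK \<in> uq_ideal"
| rel_KF: "gen genK * gen genF - const (q powi (- 2)) * gen genF * gen genK \<in> uq_ideal"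
| rel_EF: "gen genE * gen genF - gen genF * gen genE
    - const (1 / (q - q powi (- 1))) * (gen genK - gen genKi) \<in> uq_ideal"
| zero: "0 \<in> uq_ideal"
| add: "x \<in> uq_ideal \<Longrightarrow> y \<in> uq_ideal \<Longrightarrow> x + y \<in> uq_ideal"
| mult_left: "x \<in> uq_ideal \<Longrightarrow> a * x \<in> uq_ideal"
| mult_right: "x \<in> uq_ideal \<Longrightarrow> x * a \<in> uq_ideal"

lemma uq_ideal_uminus: "x \<in> uq_ideal \<Longrightarrow> - x \<in> uq_ideal"
  using uq_ideal.mult_left[of x "- 1"] by simp

lemma uq_ideal_diff: "x \<in> uq_ideal \<Longrightarrow> y \<in> uq_ideal \<Longrightarrow> x - y \<in> uq_ideal"
  using uq_ideal.add[of x "- y"] uq_ideal_uminus by simp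

lemma one_notin_uq_ideal: "1 \<notin> uq_ideal"
proof -
  define \<chi> :: "word \<Rightarrow> ratfun"
    where "\<chi> w = (if set (letters w) \<subseteq> {genK, genKi} then 1 else 0)" for w
  define L where "L p = (\<Sum>w\<in>Poly_Mapping.keys p. Poly_Mapping.lookup p w * \<chi> w)" for p
  have L_add: "L (x + y) = L x + L y" for x y
    unfolding L_def by (rule setsum_keys_plus_distrib) (simp_all add: algebra_simps)
  have L_zero: "L 0 = 0" by (simp add: L_def)
  have L_diff: "L (x - y) = L x - L y" for x y
    using L_add[of "x - y" y] by simp
  have L_single: "L (Poly_Mapping.single w c) = c * \<chi> w" for w c
    by (simp add: L_def)
  have \<chi>_plus: "\<chi> (v + w) = \<chi> v * \<chi> w" for v w
    by (simp add: \<chi>_def plus_word_def)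
  have L_mult: "L (x * y) = L x * L y" for x y
  proof (induction x rule: poly_mapping_single_induct)
    case (single v c)
    show ?case
      by (induction y rule: poly_mapping_single_induct)
        (simp_all add: mult_single L_zero L_add L_single \<chi>_plus distrib_left)
  qed (simp_all add: L_zero L_add distrib_right)
  have L_one: "L 1 = 1"
    using L_single[of 0 1] by (simp add: \<chi>_def) (simp add: zero_word_def)
  have L_gen: "L (gen g) = (if g \<in> {genK, genKi} then 1 else 0)" for g
    by (simp add: gen_def L_single \<chi>_def)
  have "L x = 0" if "x \<in> uq_ideal" for x
    using that by induction (simp_all add: L_zero L_add L_diff L_mult L_one L_gen)
  then show ?thesis using L_one by force
qed

quotient_type uq = free_alg / "\<lambda>x y. x - y \<in> uq_ideal"
proof (rule equivpI)
  show "reflp (\<lambda>x y. x - y \<in> uq_ideal)"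
    by (rule reflpI) (simp add: uq_ideal.zero)
  show "symp (\<lambda>x y. x - y \<in> uq_ideal)"
    by (rule sympI) (metis minus_diff_eq uq_ideal_uminus)
  show "transp (\<lambda>x y. x - y \<in> uq_ideal)"
    proof (rule transpI)
    fix x y z :: "free_alg"
    assume "x - y \<in> uq_ideal" "y - z \<in> uq_ideal"
    then have "(x - y) + (y - z) \<in> uq_ideal" by (rule uq_ideal.add)
    then show "x - z \<in> uq_ideal" by simp
  qed
qed

instantiation uq :: qalgebra
begin

lift_definition zero_uq :: uq is 0 .
lift_definition one_uq :: uq is 1 .
lift_definition plus_uq :: "uq \<Rightarrow> uq \<Rightarrow> uq" is "(+)"
  by (simp add: uq_ideal.add add_diff_add)
lift_definition uminus_uq :: "uq \<Rightarrow> uq" is uminus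
  by (drule uq_ideal_uminus) simp
lift_definition minus_uq :: "uq \<Rightarrow> uq \<Rightarrow> uq" is "(-)"
proof -
  fix a b c d :: free_alg
  assume "a - b \<in> uq_ideal" "c - d \<in> uq_ideal"
  then have "(a - b) - (c - d) \<in> uq_ideal" by (rule uq_ideal_diff)
  then show "a - c - (b - d) \<in> uq_ideal" by (simp add: algebra_simps)
qed
lift_definition times_uq :: "uq \<Rightarrow> uq \<Rightarrow> uq" is "(*)"
proof -
  fix a b c d :: free_alg
  assume "a - b \<in> uq_ideal" "c - d \<in> uq_ideal"
  then have "(a - b) * c + b * (c - d) \<in> uq_ideal"
    by (intro uq_ideal.add uq_ideal.mult_left uq_ideal.mult_right)
  then show "a * c - b * d \<in> uq_ideal" by (simp add: algebra_simps)
qed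
lift_definition scaleq_uq :: "ratfun \<Rightarrow> uq \<Rightarrow> uq" is "\<lambda>c x. const c * x"
  by (simp add: uq_ideal.mult_left flip: right_diff_distrib)

instance
proof
  fix a b c :: "uq" and s t :: ratfun
  show "a * b * c = a * (b * c)" by transfer (simp add: mult.assoc uq_ideal.zero)
  show "a + b + c = a + (b + c)" by transfer (simp add: add.assoc uq_ideal.zero)
  show "a + b = b + a" by transfer (simp add: uq_ideal.zero)
  show "0 + a = a" by transfer (simp add: uq_ideal.zero)
  show "- a + a = 0" by transfer (simp add: uq_ideal.zero)
  show "a - b = a + - b" by transfer (simp add: uq_ideal.zero)
  show "1 * a = a" by transfer (simp add: uq_ideal.zero)
  show "a * 1 = a" by transfer (simp add: uq_ideal.zero)
  show "(a + b) * c = a * c + b * c" by transfer (simp add: distrib_right uq_ideal.zero)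
  show "a * (b + c) = a * b + a * c" by transfer (simp add: distrib_left uq_ideal.zero)
  show "s *\<^sub>q (a + b) = s *\<^sub>q a + s *\<^sub>q b"
    by transfer (simp add: distrib_left uq_ideal.zero)
  show "(s + t) *\<^sub>q a = s *\<^sub>q a + t *\<^sub>q a"
    by transfer (simp add: distrib_right single_add uq_ideal.zero)
  show "s *\<^sub>q t *\<^sub>q a = (s * t) *\<^sub>q a"
    by transfer (simp add: mult_single uq_ideal.zero flip: mult.assoc)
  show "1 *\<^sub>q a = a" by transfer (simp add: uq_ideal.zero)
  show "(s *\<^sub>q a) * b = s *\<^sub>q (a * b)"
    by transfer (simp add: mult.assoc uq_ideal.zero)
  show "a * (s *\<^sub>q b) = s *\<^sub>q (a * b)"
    by transfer (simp add: const_mult_right uq_ideal.zero)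
  show "(0 :: uq) \<noteq> 1"
    by transfer (use uq_ideal_uminus[of "- 1"] one_notin_uq_ideal in auto)
qed

end

lift_definition uE :: uq is "gen genE" .
lift_definition uF :: uq is "gen genF" .
lift_definition uK :: uq is "gen genK" .
lift_definition uKi :: uq is "gen genKi" .

lemma uq_relations:
  "uK * uKi = 1" "uKi * uK = 1"
  "uK * uE = q powi 2 *\<^sub>q (uE * uK)"
  "uK * uF = q powi (- 2) *\<^sub>q (uF * uK)"
  "uE * uF - uF * uE = (1 / (q - q powi (- 1))) *\<^sub>q (uK - uKi)"
  subgoal by transfer (rule uq_ideal.rel_KKi)
  subgoal by transfer (rule uq_ideal.rel_KiK)
  subgoal by transfer (use uq_ideal.rel_KE in \<open>simp add: mult.assoc\<close>)
  subgoal by transfer (use uq_ideal.rel_KF in \<open>simp add: mult.assoc\<close>)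
  subgoal by transfer (rule uq_ideal.rel_EF)
  done

lemma uKi_uE: "uKi * uE = q powi (- 2) *\<^sub>q (uE * uKi)"
proof -
  have "uE * uKi = uKi * (uK * uE) * uKi"
    by (simp add: uq_relations(2) flip: mult.assoc)
  also have "\<dots> = q powi 2 *\<^sub>q (uKi * uE * (uK * uKi))"
    by (simp add: uq_relations(3) scaleq_mult_left scaleq_mult_right mult.assoc)
  finally show ?thesis
    by (simp add: uq_relations(1) scaleq_scaleq scaleq_one q_nonzero power_int_minus)
qed

definition Kpow :: "int \<Rightarrow> uq" where
  "Kpow m = (if m \<ge> 0 then uK ^ nat m else uKi ^ nat (- m))"

text \<open>
  The index monoid \<open>('a, 'b) pure\<close> is the multiplicative monoid of \<open>'a \<times> 'b\<close>, written
  additively so that \<open>('a, 'b) pure \<Rightarrow>\<^sub>0 ratfun\<close> is the free vector space on \<open>'a \<times> 'b\<close> with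
  the product \<open>(a, b) (c, d) = (a c, b d)\<close>.
\<close>

datatype ('a, 'b) pure = Pure (pure_fst: 'a) (pure_snd: 'b)

instantiation pure :: (monoid_mult, monoid_mult) monoid_add
begin
definition "0 = Pure 1 1"
definition "v + w = Pure (pure_fst v * pure_fst w) (pure_snd v * pure_snd w)"
instance by standard (simp_all add: zero_pure_def plus_pure_def mult.assoc)
end

type_synonym ('a, 'b) pre_tensor = "('a, 'b) pure \<Rightarrow>\<^sub>0 ratfun"

definition pre_tensor :: "'a \<Rightarrow> 'b \<Rightarrow> ('a, 'b) pre_tensor" where
  "pre_tensor a b = Poly_Mapping.single (Pure a b) 1"

inductive_set tensor_null :: "('a::qalgebra, 'b::qalgebra) pre_tensor set" where
  add_left: "pre_tensor (a + a') b - pre_tensor a b - pre_tensor a' b \<in> tensor_null"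
| add_right: "pre_tensor a (b + b') - pre_tensor a b - pre_tensor a b' \<in> tensor_null"
| scale_left: "pre_tensor (c *\<^sub>q a) b - const c * pre_tensor a b \<in> tensor_null"
| scale_right: "pre_tensor a (c *\<^sub>q b) - const c * pre_tensor a b \<in> tensor_null"
| zero: "0 \<in> tensor_null"
| add: "x \<in> tensor_null \<Longrightarrow> y \<in> tensor_null \<Longrightarrow> x + y \<in> tensor_null"
| scale: "x \<in> tensor_null \<Longrightarrow> const c * x \<in> tensor_null"

lemma tensor_null_uminus: "x \<in> tensor_null \<Longrightarrow> - x \<in> tensor_null"
  using tensor_null.scale[of x "- 1"] by (simp add: single_uminus)

lemma tensor_null_diff: "x \<in> tensor_null \<Longrightarrow> y \<in> tensor_null \<Longrightarrow> x - y \<in> tensor_null"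
  using tensor_null.add[of x "- y"] tensor_null_uminus[of y] by simp

lemma pre_tensor_mult:
  "pre_tensor a b * pre_tensor c d = pre_tensor (a * c) (b * d)"
  for a c :: "'a::qalgebra" and b d :: "'b::qalgebra"
  by (simp add: pre_tensor_def mult_single plus_pure_def)

lemma single_eq_pre_tensor:
  "Poly_Mapping.single w c = const c * pre_tensor (pure_fst w) (pure_snd w)"
  for w :: "('a::qalgebra, 'b::qalgebra) pure"
  by (simp add: pre_tensor_def mult_single)

lemma pre_tensor_mult_null:
  "x \<in> tensor_null \<Longrightarrow> pre_tensor a b * x \<in> tensor_null"
by (induction rule: tensor_null.induct)
    (simp_all add: right_diff_distrib pre_tensor_mult distrib_left scaleq_mult_right
      const_mult_right[of "pre_tensor a b"] tensor_null.intros)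

lemma null_mult_pre_tensor:
  "x \<in> tensor_null \<Longrightarrow> x * pre_tensor a b \<in> tensor_null"
  by (induction rule: tensor_null.induct)
    (simp_all add: left_diff_distrib pre_tensor_mult distrib_right mult.assoc scaleq_mult_left
      tensor_null.intros)

lemma tensor_null_mult_left: "x \<in> tensor_null \<Longrightarrow> y * x \<in> tensor_null"
proof (induction y rule: poly_mapping_single_induct)
  case (single w c)
  then show ?case
    by (simp add: single_eq_pre_tensor[of w c] mult.assoc pre_tensor_mult_null tensor_null.scale)
qed (simp_all add: distrib_right tensor_null.intros)

lemma tensor_null_mult_right: "x \<in> tensor_null \<Longrightarrow> x * y \<in> tensor_null"
proof (induction y rule: poly_mapping_single_induct)
  case (single w c)
  then show ?case
    by (simp add: single_eq_pre_tensor[of w c] const_mult_right[of x] null_mult_pre_tensor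
        tensor_null.scale)
qed (simp_all add: distrib_left tensor_null.intros)

lemma exists_linear_functional:
  obtains \<phi> :: "'a::qalgebra \<Rightarrow> ratfun"
  where "\<And>x y. \<phi> (x + y) = \<phi> x + \<phi> y" "\<And>c x. \<phi> (c *\<^sub>q x) = c * \<phi> x" "\<phi> 1 = 1"
proof -
  interpret vector_space_pair "scaleq :: ratfun \<Rightarrow> 'a \<Rightarrow> 'a" "(*) :: ratfun \<Rightarrow> ratfun \<Rightarrow> ratfun"
    by unfold_locales
      (simp_all add: scaleq_add_left scaleq_add_right scaleq_scaleq scaleq_one algebra_simps)
  have "vs1.independent {1 :: 'a}" by simp
  then obtain \<phi> :: "'a \<Rightarrow> ratfun" where \<phi>: "Vector_Spaces.linear scaleq (*) \<phi>" "\<forall>x\<in>{1}. \<phi> x = 1"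
    using linear_independent_extend[of "{1}" "\<lambda>_. 1"] by blast
  interpret Vector_Spaces.linear scaleq "(*)" \<phi> by (rule \<phi>(1))
  show ?thesis using that[of \<phi>] \<phi>(2) add scale by simp
qed

lemma one_notin_tensor_null: "(1 :: ('a::qalgebra, 'b::qalgebra) pre_tensor) \<notin> tensor_null"
proof -
  obtain \<phi> :: "'a \<Rightarrow> ratfun" where
    \<phi>: "\<And>x y. \<phi> (x + y) = \<phi> x + \<phi> y" "\<And>c x. \<phi> (c *\<^sub>q x) = c * \<phi> x" "\<phi> 1 = 1"
    by (rule exists_linear_functional) blast
  obtain \<psi> :: "'b \<Rightarrow> ratfun" where
    \<psi>: "\<And>x y. \<psi> (x + y) = \<psi> x + \<psi> y" "\<And>c x. \<psi> (c *\<^sub>q x) = c * \<psi> x" "\<psi> 1 = 1"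
    by (rule exists_linear_functional) blast
  define L where "L p = (\<Sum>w\<in>Poly_Mapping.keys p.
      Poly_Mapping.lookup p w * (\<phi> (pure_fst w) * \<psi> (pure_snd w)))" for p
  have L_add: "L (x + y) = L x + L y" for x y
    unfolding L_def by (rule setsum_keys_plus_distrib) (simp_all add: algebra_simps)
  have L_zero: "L 0 = 0" by (simp add: L_def)
  have L_diff: "L (x - y) = L x - L y" for x y
    using L_add[of "x - y" y] by simp
  have L_single: "L (Poly_Mapping.single w c) = c * (\<phi> (pure_fst w) * \<psi> (pure_snd w))" for w c
    by (simp add: L_def)
  have L_const: "L (const c * x) = c * L x" for c x
    by (induction x rule: poly_mapping_single_induct)
      (simp_all add: L_zero L_add L_single mult_single distrib_left mult.assoc)
  have L_pre: "L (pre_tensor a b) = \<phi> a * \<psi> b" for a b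
    by (simp add: pre_tensor_def L_single)
  have "L x = 0" if "x \<in> tensor_null" for x
    using that
    by induction (simp_all add: L_zero L_add L_diff L_const L_pre \<phi> \<psi> algebra_simps)
  moreover have "L 1 = 1"
    using L_single[of 0 1] by simp (simp add: zero_pure_def \<phi> \<psi>)
  ultimately show ?thesis by force
qed

quotient_type (overloaded) ('a, 'b) tensor =
  "('a::qalgebra, 'b::qalgebra) pre_tensor" / "\<lambda>x y. x - y \<in> tensor_null"
proof (rule equivpI)
  show "reflp (\<lambda>x y :: ('a, 'b) pre_tensor. x - y \<in> tensor_null)"
    by (rule reflpI) (simp add: tensor_null.zero)
  show "symp (\<lambda>x y :: ('a, 'b) pre_tensor. x - y \<in> tensor_null)"
    by (rule sympI) (metis minus_diff_eq tensor_null_uminus)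
  show "transp (\<lambda>x y :: ('a, 'b) pre_tensor. x - y \<in> tensor_null)"
    proof (rule transpI)
    fix x y z :: "('a, 'b) pre_tensor"
    assume "x - y \<in> tensor_null" "y - z \<in> tensor_null"
    then have "(x - y) + (y - z) \<in> tensor_null" by (rule tensor_null.add)
    then show "x - z \<in> tensor_null" by simp
  qed
qed

instantiation tensor :: (qalgebra, qalgebra) qalgebra
begin

lift_definition zero_tensor :: "('a, 'b) tensor" is 0 .
lift_definition one_tensor :: "('a, 'b) tensor" is 1 .
lift_definition plus_tensor :: "('a, 'b) tensor \<Rightarrow> ('a, 'b) tensor \<Rightarrow> ('a, 'b) tensor" is "(+)"
  by (simp add: tensor_null.add add_diff_add)
lift_definition uminus_tensor :: "('a, 'b) tensor \<Rightarrow> ('a, 'b) tensor" is uminus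
  by (drule tensor_null_uminus) simp
lift_definition minus_tensor :: "('a, 'b) tensor \<Rightarrow> ('a, 'b) tensor \<Rightarrow> ('a, 'b) tensor" is "(-)"
proof -
  fix a b c d :: "('a, 'b) pre_tensor"
  assume "a - b \<in> tensor_null" "c - d \<in> tensor_null"
  then have "(a - b) - (c - d) \<in> tensor_null" by (rule tensor_null_diff)
  then show "a - c - (b - d) \<in> tensor_null" by (simp add: algebra_simps)
qed
lift_definition times_tensor :: "('a, 'b) tensor \<Rightarrow> ('a, 'b) tensor \<Rightarrow> ('a, 'b) tensor" is "(*)"
proof -
  fix a b c d :: "('a, 'b) pre_tensor"
  assume "a - b \<in> tensor_null" "c - d \<in> tensor_null"
  then have "(a - b) * c + b * (c - d) \<in> tensor_null"
    by (intro tensor_null.add tensor_null_mult_left tensor_null_mult_right)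
  then show "a * c - b * d \<in> tensor_null" by (simp add: algebra_simps)
qed
lift_definition scaleq_tensor :: "ratfun \<Rightarrow> ('a, 'b) tensor \<Rightarrow> ('a, 'b) tensor"
  is "\<lambda>c x. const c * x"
  by (simp add: tensor_null.scale flip: right_diff_distrib)

instance
proof
  fix a b c :: "('a, 'b) tensor" and s t :: ratfun
  show "a * b * c = a * (b * c)" by transfer (simp add: mult.assoc tensor_null.zero)
  show "a + b + c = a + (b + c)" by transfer (simp add: add.assoc tensor_null.zero)
  show "a + b = b + a" by transfer (simp add: tensor_null.zero)
  show "0 + a = a" by transfer (simp add: tensor_null.zero)
  show "- a + a = 0" by transfer (simp add: tensor_null.zero)
  show "a - b = a + - b" by transfer (simp add: tensor_null.zero)
  show "1 * a = a" by transfer (simp add: tensor_null.zero)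
  show "a * 1 = a" by transfer (simp add: tensor_null.zero)
  show "(a + b) * c = a * c + b * c" by transfer (simp add: distrib_right tensor_null.zero)
  show "a * (b + c) = a * b + a * c" by transfer (simp add: distrib_left tensor_null.zero)
  show "s *\<^sub>q (a + b) = s *\<^sub>q a + s *\<^sub>q b"
    by transfer (simp add: distrib_left tensor_null.zero)
  show "(s + t) *\<^sub>q a = s *\<^sub>q a + t *\<^sub>q a"
    by transfer (simp add: distrib_right single_add tensor_null.zero)
  show "s *\<^sub>q t *\<^sub>q a = (s * t) *\<^sub>q a"
    by transfer (simp add: mult_single tensor_null.zero flip: mult.assoc)
  show "1 *\<^sub>q a = a" by transfer (simp add: tensor_null.zero)
  show "(s *\<^sub>q a) * b = s *\<^sub>q (a * b)"
    by transfer (simp add: mult.assoc tensor_null.zero)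
  show "a * (s *\<^sub>q b) = s *\<^sub>q (a * b)"
    by transfer (simp add: const_mult_right tensor_null.zero)
  show "(0 :: ('a, 'b) tensor) \<noteq> 1"
    by transfer (use tensor_null_uminus[of "- 1"] one_notin_tensor_null in auto)
qed

end

lift_definition tensor :: "'a::qalgebra \<Rightarrow> 'b::qalgebra \<Rightarrow> ('a, 'b) tensor"  (infixr \<open>\<otimes>\<close> 72)
  is pre_tensor .

lemma tensor_add_left: "(a + a') \<otimes> b = a \<otimes> b + a' \<otimes> b"
  by transfer (use tensor_null.add_left in \<open>simp add: algebra_simps\<close>)

lemma tensor_add_right: "a \<otimes> (b + b') = a \<otimes> b + a \<otimes> b'"
  by transfer (use tensor_null.add_right in \<open>simp add: algebra_simps\<close>)

lemma tensor_scale_left: "(c *\<^sub>q a) \<otimes> b = c *\<^sub>q (a \<otimes> b)"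
  by transfer (rule tensor_null.scale_left)

lemma tensor_scale_right: "a \<otimes> (c *\<^sub>q b) = c *\<^sub>q (a \<otimes> b)"
  by transfer (rule tensor_null.scale_right)

lemma tensor_mult: "(a \<otimes> b) * (c \<otimes> d) = (a * c) \<otimes> (b * d)"
  by transfer (simp add: pre_tensor_mult tensor_null.zero)

lemma tensor_one: "1 \<otimes> 1 = 1"
  by transfer (simp add: pre_tensor_def tensor_null.zero flip: zero_pure_def)

lemma tensor_diff_right: "a \<otimes> (b - b') = a \<otimes> b - a \<otimes> b'"
  using tensor_add_right[of a "b - b'" b'] by simp

lemma tensor_diff_left: "(a - a') \<otimes> b = a \<otimes> b - a' \<otimes> b"
  using tensor_add_left[of "a - a'" a' b] by simp

fun comult_gen :: "gen \<Rightarrow> (uq, uq) tensor" where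
  "comult_gen genE = uE \<otimes> 1 + uK \<otimes> uE"
| "comult_gen genF = 1 \<otimes> uF + uF \<otimes> uKi"
| "comult_gen genK = uK \<otimes> uK"
| "comult_gen genKi = uKi \<otimes> uKi"

lemma free_eval_comult_gen_ideal: "x \<in> uq_ideal \<Longrightarrow> free_eval comult_gen x = 0"
proof (induction rule: uq_ideal.induct)
  case rel_KE
  show ?case
    by (simp add: free_eval_diff free_eval_mult free_eval_gen free_eval_const tensor_mult
        uq_relations(3) distrib_left distrib_right scaleq_mult_left tensor_scale_left
        tensor_scale_right scaleq_add_right)
next
  case rel_KF
  show ?case
    by (simp add: free_eval_diff free_eval_mult free_eval_gen free_eval_const tensor_mult
        uq_relations(1,2,4) distrib_left distrib_right scaleq_mult_left tensor_scale_left
        tensor_scale_right scaleq_add_right)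
next
  case rel_EF
  have "comult_gen genE * comult_gen genF - comult_gen genF * comult_gen genE
      = (uE * uF - uF * uE) \<otimes> uKi + uK \<otimes> (uE * uF - uF * uE)"
    by (simp add: tensor_mult uq_relations(4) uKi_uE distrib_left distrib_right
        tensor_scale_left tensor_scale_right tensor_diff_left tensor_diff_right)
  also have "\<dots> = (1 / (q - q powi (- 1))) *\<^sub>q (comult_gen genK - comult_gen genKi)"
    by (simp only: uq_relations(5) tensor_scale_left tensor_scale_right tensor_diff_left
        tensor_diff_right comult_gen.simps flip: scaleq_add_right) simp
  finally show ?case
    by (simp add: free_eval_diff free_eval_mult free_eval_gen free_eval_const scaleq_mult_left)
qed (simp_all add: free_eval_diff free_eval_add free_eval_mult free_eval_gen free_eval_one
    free_eval_zero free_eval_const tensor_mult tensor_one uq_relations(1,2))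

lift_definition comult :: "uq \<Rightarrow> (uq, uq) tensor" is "free_eval comult_gen"
  by (metis free_eval_comult_gen_ideal free_eval_diff eq_iff_diff_eq_0)

lemma comult_gens:
  "comult uE = uE \<otimes> 1 + uK \<otimes> uE"
  "comult uF = 1 \<otimes> uF + uF \<otimes> uKi"
  "comult uK = uK \<otimes> uK"
  "comult uKi = uKi \<otimes> uKi"
  by (transfer; simp add: free_eval_gen)+

lemma comult_hom:
  "comult 1 = 1"
  "comult (x + y) = comult x + comult y"
  "comult (x * y) = comult x * comult y"
  "comult (c *\<^sub>q x) = c *\<^sub>q comult x"
  by (transfer; simp add: free_eval_one free_eval_add free_eval_mult free_eval_const
      scaleq_mult_left)+

definition divpow :: "uq \<Rightarrow> nat \<Rightarrow> uq" where
  "divpow x a = (1 / qfact a) *\<^sub>q x ^ a"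

definition Echeck :: "ratfun \<Rightarrow> uq" where
  "Echeck \<zeta> = \<zeta> *\<^sub>q (uE * Kpow (- 1))"

definition Bgen :: "ratfun \<Rightarrow> uq" where
  "Bgen \<zeta> = uF + Echeck \<zeta>"

text \<open>
  \<^typ>\<open>uq\<close> is not commutative, hence the list products in the following definitions; the
  factors commute, so their order is immaterial.
\<close>

definition hbinom :: "int \<Rightarrow> nat \<Rightarrow> uq" where
  "hbinom a n = (\<Prod>i\<leftarrow>[1..<n + 1].
    (1 / (q powi (4 * int i) - 1)) *\<^sub>q (q powi (4 * a + 4 * int i - 4) *\<^sub>q Kpow (- 2) - 1))"

definition idivpow1 :: "ratfun \<Rightarrow> nat \<Rightarrow> uq" where
  "idivpow1 \<zeta> n = (1 / qfact n) *\<^sub>q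
    (let P = (\<Prod>j\<leftarrow>[1..<n div 2 + 1].
           Bgen \<zeta> ^ 2 - (q * \<zeta> * qint (2 * int j - 1) ^ 2) *\<^sub>q 1)
     in if odd n then Bgen \<zeta> * P else P)"

end

theory Submission
  imports Defs
begin

text \<open>
  Since \<open>\<Delta>(B) = B \<otimes> K\<^sup>-\<^sup>1 + 1 \<otimes> B\<close> and \<open>B\<close> times a divided power is a combination of two
  divided powers, induction on \<open>n\<close> reduces the formula to a recursion for its second tensor
  factors.  In the triangular form \<open>E\<^sup>(\<^sup>a\<^sup>) f(K) F\<^sup>(\<^sup>b\<^sup>)\<close> the recursion splits over the
  triples \<open>(a, b, c)\<close> with \<open>a + b + 2c = r\<close>.  For each of them all bracket elements that occur
  share a factor \<open>[h;\<beta>;c-1]\<close>, whose cofactors are linear in \<open>K\<^sup>-\<^sup>2\<close>; comparing the two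
  coefficients of these cofactors leaves rational identities in \<open>q\<close>, \<open>q\<^sup>a\<close>, \<open>q\<^sup>b\<close>, \<open>q\<^sup>c\<close> and
  \<open>q\<^sup>m\<close>, where \<open>m = n - r\<close>.
\<close>

section \<open>Quantum integers and the generators\<close>

lemma q_power: "q ^ n = Fraction_Field.Fract (monom 1 n) 1"
  by (induction n) (simp_all add: q_def One_fract_def monom_Suc one_pCons monom_0)

text \<open>Comparing degrees of monomials shows that \<open>q\<close> is not a root of unity; the
  nonvanishing of \<open>qint\<close>, \<open>qfact\<close>, \<open>q ^ 2 - 1\<close> and
  \<open>q powi (4 * c) - 1\<close> goes back to this.\<close>

lemma q_power_eq_1_iff: "q ^ n = 1 \<longleftrightarrow> n = 0"
proof
  assume "q ^ n = 1"
  then have "monom 1 n = (1 :: rat poly)"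
    by (simp add: q_power One_fract_def eq_fract)
  then show "n = 0"
    by (metis degree_1 degree_monom_eq one_neq_zero)
qed simp

lemma q_powi_eq_1_iff: "q powi k = 1 \<longleftrightarrow> k = 0"
proof (cases "k \<ge> 0")
  case True
  then show ?thesis using q_power_eq_1_iff[of "nat k"] by (simp add: power_int_def)
next
  case False
  then show ?thesis using q_power_eq_1_iff[of "nat (- k)"]
    by (simp add: power_int_def power_inverse inverse_eq_1_iff)
qed

lemma q_square_neq_1: "q ^ 2 \<noteq> 1"
  by (simp add: q_power_eq_1_iff)

lemma q_powi_diff_nonzero: "k \<noteq> 0 \<Longrightarrow> q powi k - q powi (- k) \<noteq> 0"
proof
  assume "k \<noteq> 0" "q powi k - q powi (- k) = 0"
  then have "q powi k * q powi k = q powi (- k) * q powi k" by simp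
  then have "q powi (k + k) = 1" by (simp add: q_nonzero flip: power_int_add)
  then show False using \<open>k \<noteq> 0\<close> by (simp add: q_powi_eq_1_iff)
qed

lemma qint_eq_0_iff: "qint k = 0 \<longleftrightarrow> k = 0"
  using q_powi_diff_nonzero[of k] q_powi_diff_nonzero[of 1]
  by (cases "k = 0") (simp_all add: qint_def)

lemma qfact_Suc: "qfact (Suc n) = qfact n * qint (int (Suc n))"
  by (simp add: qfact_def)

lemma qfact_nonzero: "qfact n \<noteq> 0"
  by (induction n) (simp_all add: qfact_Suc qint_eq_0_iff, simp add: qfact_def)

lemma qint_0: "qint 0 = 0" by (simp add: qint_def)

lemma scaleq_sum_right: "c *\<^sub>q sum f A = (\<Sum>i\<in>A. c *\<^sub>q f i)"
  by (induction A rule: infinite_finite_induct) (simp_all add: scaleq_zero_right scaleq_add_right)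

lemma scaleq_diff_right: "c *\<^sub>q (x - y) = c *\<^sub>q x - c *\<^sub>q (y :: 'a::qalgebra)"
  using scaleq_add_right[of c "x - y" y] by simp

lemma tensor_zero_left: "0 \<otimes> a = 0"
  using tensor_add_left[of 0 0 a] by simp

lemma tensor_zero_right: "a \<otimes> 0 = 0"
  using tensor_add_right[of a 0 0] by simp

lemma divpow_0: "divpow x 0 = 1"
  by (simp add: divpow_def qfact_def scaleq_one)

lemma mult_divpow: "x * divpow x n = qint (int (Suc n)) *\<^sub>q divpow x (Suc n)"
  by (simp add: divpow_def scaleq_mult_right scaleq_scaleq qfact_Suc qfact_nonzero qint_eq_0_iff)

lemma divpow_commutation:
  assumes "y * x = s *\<^sub>q (x * y)"
  shows "y * divpow x n = s ^ n *\<^sub>q (divpow x n * y)"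
proof -
  have "y * x ^ n = s ^ n *\<^sub>q (x ^ n * y)"
  proof (induction n)
    case (Suc n)
    have "y * x ^ Suc n = (y * x) * x ^ n" by (simp add: mult.assoc)
    also have "\<dots> = s *\<^sub>q (x * (y * x ^ n))"
      by (simp add: assms scaleq_mult_left mult.assoc)
    finally show ?case by (simp add: Suc scaleq_mult_right scaleq_scaleq mult.assoc)
  qed (simp add: scaleq_one)
  then show ?thesis
    by (simp add: divpow_def scaleq_mult_left scaleq_mult_right scaleq_scaleq mult.commute)
qed

section \<open>Integral powers of K and their commutation with E and F\<close>

lemma Kpow_0: "Kpow 0 = 1" by (simp add: Kpow_def)

lemma Kpow_succ: "Kpow (m + 1) = uK * Kpow m"
proof (cases "m \<ge> 0")
  case True
  then show ?thesis by (simp add: Kpow_def nat_add_distrib)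
next
  case False
  then have "nat (- m) = Suc (nat (- (m + 1)))" by simp
  then have "uKi ^ nat (- m) = uKi * uKi ^ nat (- (m + 1))"
    by (simp only: power_Suc)
  then have "uK * Kpow m = (uK * uKi) * uKi ^ nat (- (m + 1))"
    using False by (simp add: Kpow_def mult.assoc)
  then show ?thesis using False
    by (auto simp: uq_relations Kpow_def)
qed

lemma Kpow_pred: "Kpow (m - 1) = uKi * Kpow m"
proof -
  have "uKi * Kpow m = (uKi * uK) * Kpow (m - 1)"
    using Kpow_succ[of "m - 1"] by (simp add: mult.assoc)
  then show ?thesis by (simp add: uq_relations)
qed

lemma Kpow_add: "Kpow (m + n) = Kpow m * Kpow n"
proof (induction m rule: int_induct[where k = 0])
  case (step1 i)
  then show ?case using Kpow_succ[of "i + n"] Kpow_succ[of i] by (simp add: ac_simps)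
next
  case (step2 i)
  then show ?case using Kpow_pred[of "i + n"] by (simp add: Kpow_pred algebra_simps)
qed (simp add: Kpow_0)

lemma Kpow_minus_1: "Kpow (- 1) = uKi" by (simp add: Kpow_def)

lemma uKi_uF: "uKi * uF = q powi 2 *\<^sub>q (uF * uKi)"
proof -
  have "uF * uKi = uKi * (uK * uF) * uKi"
    by (simp add: uq_relations(2) flip: mult.assoc)
  also have "\<dots> = q powi (- 2) *\<^sub>q (uKi * uF * (uK * uKi))"
    by (simp only: uq_relations(4) scaleq_mult_left scaleq_mult_right mult.assoc)
  finally show ?thesis
    by (simp add: uq_relations(1) scaleq_scaleq scaleq_one q_nonzero power_int_minus)
qed

lemma Kpow_comm:
  assumes "uK * x = q powi s *\<^sub>q (x * uK)" "uKi * x = q powi (- s) *\<^sub>q (x * uKi)"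
  shows "Kpow m * x = q powi (s * m) *\<^sub>q (x * Kpow m)"
proof (induction m rule: int_induct[where k = 0])
  case (step1 i)
  have "Kpow (i + 1) * x = q powi (s * i) *\<^sub>q ((uK * x) * Kpow i)"
    using step1 by (simp add: Kpow_succ mult.assoc scaleq_mult_right)
  also have "\<dots> = q powi (s * (i + 1)) *\<^sub>q (x * Kpow (i + 1))"
    by (simp add: assms Kpow_succ mult.assoc scaleq_mult_left scaleq_scaleq
        distrib_left power_int_add q_nonzero)
  finally show ?case .
next
  case (step2 i)
  have "Kpow (i - 1) * x = q powi (s * i) *\<^sub>q ((uKi * x) * Kpow i)"
    using step2 by (simp add: Kpow_pred mult.assoc scaleq_mult_right)
  also have "\<dots> = q powi (s * (i - 1)) *\<^sub>q (x * Kpow (i - 1))"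
    by (simp add: assms Kpow_pred mult.assoc scaleq_mult_left scaleq_scaleq
        right_diff_distrib power_int_diff power_int_minus q_nonzero divide_simps)
  finally show ?case .
qed (simp add: Kpow_0 scaleq_one)

lemma Kpow_uE: "Kpow m * uE = q powi (2 * m) *\<^sub>q (uE * Kpow m)"
  by (rule Kpow_comm) (simp_all add: uq_relations(3) uKi_uE)

lemma Kpow_uF: "Kpow m * uF = q powi (- 2 * m) *\<^sub>q (uF * Kpow m)"
  by (rule Kpow_comm) (simp_all add: uq_relations(4) uKi_uF)

lemma uF_Kpow: "uF * Kpow m = q powi (2 * m) *\<^sub>q (Kpow m * uF)"
  by (simp add: Kpow_uF scaleq_scaleq scaleq_one q_nonzero flip: power_int_add)

lemma Kpow_Echeck: "Kpow m * Echeck \<zeta> = q powi (2 * m) *\<^sub>q (Echeck \<zeta> * Kpow m)"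
proof -
  have "Kpow m * Echeck \<zeta> = \<zeta> *\<^sub>q ((Kpow m * uE) * Kpow (- 1))"
    by (simp add: Echeck_def scaleq_mult_right mult.assoc)
  also have "\<dots> = q powi (2 * m) *\<^sub>q (\<zeta> *\<^sub>q (uE * Kpow (m + - 1)))"
    by (simp only: Kpow_uE scaleq_mult_left scaleq_scaleq mult.assoc mult.commute Kpow_add)
  also have "\<dots> = q powi (2 * m) *\<^sub>q (\<zeta> *\<^sub>q (uE * Kpow (- 1 + m)))"
    by (simp add: add.commute)
  finally show ?thesis
    by (simp only: Echeck_def Kpow_add scaleq_mult_left mult.assoc)
qed

lemma Kpow_divpow_Echeck:
  "Kpow m * divpow (Echeck \<zeta>) a = q powi (2 * m * int a) *\<^sub>q (divpow (Echeck \<zeta>) a * Kpow m)"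
  using divpow_commutation[OF Kpow_Echeck] by (simp add: power_int_mult)

text \<open>Multiplying the relation for EF - FE on the right by K^-1 turns K - K^-1 into 1 - K^-2,
  so the correction is linear in K^-2; the factor q^-2 comes from moving F past K^-1.\<close>

lemma uF_Echeck:
  "uF * Echeck \<zeta> = q powi (- 2) *\<^sub>q (Echeck \<zeta> * uF) + (q * \<zeta> / (q ^ 2 - 1)) *\<^sub>q (Kpow (- 2) - 1)"
proof -
  have "uF * uE = uE * uF - (1 / (q - q powi (- 1))) *\<^sub>q (uK - uKi)"
    using uq_relations(5) by (simp add: algebra_simps)
  then have "uF * (uE * uKi) = uE * (uF * uKi) - (1 / (q - q powi (- 1))) *\<^sub>q (uK * uKi - uKi * uKi)"
    by (metis mult.assoc left_diff_distrib scaleq_mult_left)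
  moreover have "uF * uKi = q powi (- 2) *\<^sub>q (uKi * uF)"
    by (simp add: uKi_uF scaleq_scaleq scaleq_one q_nonzero power_int_minus)
  moreover have "Kpow (- 2) = uKi * uKi" by (simp add: Kpow_def power2_eq_square)
  moreover have "1 / (q - q powi (- 1)) = q / (q ^ 2 - 1)"
    using q_nonzero q_square_neq_1
    by (simp add: power_int_minus divide_simps) (auto simp: power2_eq_square)
  ultimately have "uF * (uE * uKi) = q powi (- 2) *\<^sub>q (uE * uKi * uF)
      + (q / (q ^ 2 - 1)) *\<^sub>q (Kpow (- 2) - 1)"
    by (simp add: uq_relations(1) scaleq_mult_right mult.assoc scaleq_diff_right)
  then show ?thesis
    by (simp add: Echeck_def Kpow_minus_1 scaleq_mult_right scaleq_mult_left scaleq_scaleq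
       scaleq_add_right scaleq_diff_right mult.commute)
qed

text \<open>After multiplication by K^-1 the summand \<open>uK \<otimes> uE\<close> has first factor
  1. The first factors are thus 1 and \<open>Bgen \<zeta>\<close>, which allows an expansion in
  divided powers on the left.\<close>

lemma comult_Bgen: "comult (Bgen \<zeta>) = Bgen \<zeta> \<otimes> Kpow (- 1) + 1 \<otimes> Bgen \<zeta>"
  by (simp add: Bgen_def Echeck_def Kpow_minus_1 comult_hom comult_gens tensor_mult
      tensor_add_left tensor_add_right tensor_scale_left tensor_scale_right distrib_right
      uq_relations(1) scaleq_add_right)

section \<open>Triangular forms\<close>

lemma scaleq_diff_left: "(c - d) *\<^sub>q x = c *\<^sub>q x - d *\<^sub>q (x :: 'a::qalgebra)"
  using scaleq_add_left[of "c - d" d x] by simp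

lemmas scaleq_simps = scaleq_mult_left scaleq_mult_right scaleq_scaleq scaleq_add_left
  scaleq_add_right scaleq_diff_left scaleq_diff_right scaleq_zero_left scaleq_zero_right scaleq_one
  scaleq_minus_left scaleq_minus_right

lemma qint_alt: "qint k = (q powi k - q powi (- k)) * (q / (q ^ 2 - 1))"
proof -
  have "q - inverse q = (q ^ 2 - 1) / q"
    using q_nonzero by (simp add: field_simps power2_eq_square)
  then show ?thesis by (simp add: qint_def power_int_minus)
qed

text \<open>Oriented towards powers of the atoms \<open>q powi x\<close>, so that
  \<open>powi_simps\<close> makes a scalar identity rational in finitely many atoms; clearing
  denominators and \<open>algebra\<close> then settle it.\<close>

lemma q_powi_numeral_mult: "q powi (numeral k * x) = (q powi x) ^ numeral k"
  by (metis mult.commute of_nat_numeral power_int_mult power_int_of_nat)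

lemmas powi_simps = qint_alt power_int_add power_int_diff power_int_minus q_powi_numeral_mult
  q_nonzero

lemma q_powi_mult: "i + j = k \<Longrightarrow> q powi i * q powi j = q powi k"
  by (auto simp: power_int_add q_nonzero)

lemma scaleq_cancel: "c \<noteq> 0 \<Longrightarrow> c *\<^sub>q x = c *\<^sub>q y \<Longrightarrow> x = (y :: 'a::qalgebra)"
  by (metis scaleq_scaleq scaleq_one left_inverse)

text \<open>The coefficients of K^-2 and of 1 in the induction step of
  \<open>uF_divpow_Echeck\<close>.\<close>

lemma qint_shift_identities:
  fixes a :: int
  shows "qint (a + 1) * q powi (- 3 * a - 2) + q powi (- 4 * (a + 1))
      = qint (a + 2) * q powi (- 3 * (a + 1))"
    and "qint (a + 1) * q powi (- a - 2) + 1 = qint (a + 2) * q powi (- (a + 1))"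
proof -
  define A where "A = q powi a"
  have nz: "A \<noteq> 0" "q ^ 2 - 1 \<noteq> 0"
    by (simp_all add: A_def q_nonzero q_square_neq_1)
  show "qint (a + 1) * q powi (- 3 * a - 2) + q powi (- 4 * (a + 1))
      = qint (a + 2) * q powi (- 3 * (a + 1))"
    using nz
    by (simp add: powi_simps minus_mult_left[symmetric] del: minus_mult_left flip: A_def)
      (simp add: divide_simps q_nonzero, algebra)
  show "qint (a + 1) * q powi (- a - 2) + 1 = qint (a + 2) * q powi (- (a + 1))"
    using nz
    by (simp add: powi_simps flip: A_def)
      (simp add: divide_simps q_nonzero, algebra)
qed

text \<open>F passes one factor at a time and each passage leaves a multiple of K^-2 - 1; moving
  K^-2 past the remaining power explains the different exponents -3a and -a. Indexing by
  \<open>Suc a\<close> keeps the lower power natural.\<close>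

lemma uF_divpow_Echeck:
  "uF * divpow (Echeck \<zeta>) (Suc a) =
     q powi (- 2 * (int a + 1)) *\<^sub>q (divpow (Echeck \<zeta>) (Suc a) * uF)
   + (q * \<zeta> / (q ^ 2 - 1)) *\<^sub>q (divpow (Echeck \<zeta>) a
       * (q powi (- 3 * int a) *\<^sub>q Kpow (- 2) - q powi (- int a) *\<^sub>q 1))"
proof (induction a)
  case 0
  have "divpow (Echeck \<zeta>) (Suc 0) = Echeck \<zeta>"
    using mult_divpow[of "Echeck \<zeta>" 0] q_powi_diff_nonzero[of 1]
    by (simp add: divpow_0 qint_def scaleq_one)
  then show ?case by (simp add: uF_Echeck divpow_0 scaleq_one)
next
  case (Suc a)
  let ?E = "Echeck \<zeta>" and ?D = "divpow (Echeck \<zeta>)" and ?k = "q * \<zeta> / (q ^ 2 - 1)"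
  let ?a = "int a" and ?x = "Kpow (- 2)"
  have x: "?x * ?D (Suc a) = q powi (- 4 * (?a + 1)) *\<^sub>q (?D (Suc a) * ?x)"
    using Kpow_divpow_Echeck[of "- 2" \<zeta> "Suc a"] by (simp add: algebra_simps)
  have ED: "?E * ?D n = qint (int n + 1) *\<^sub>q ?D (Suc n)" for n
    using mult_divpow[of ?E n] by (simp add: add.commute)
  have E: "?E * (?D n * y) = qint (int n + 1) *\<^sub>q (?D (Suc n) * y)" for n y
    using ED[of n] by (metis mult.assoc scaleq_mult_left)
  \<comment> \<open>Multiplying by \<open>qint (?a + 2)\<close> turns the divided power into
    \<open>?E * ?D (Suc a)\<close>; this nonzero scalar is cancelled at the end.\<close>
  have "qint (?a + 2) *\<^sub>q (uF * ?D (Suc (Suc a))) = uF * ?E * ?D (Suc a)"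
    using ED[of "Suc a"] by (simp add: mult.assoc scaleq_simps add.commute)
  also have "\<dots> = q powi (- 2) *\<^sub>q (?E * (uF * ?D (Suc a))) + ?k *\<^sub>q (?x * ?D (Suc a) - ?D (Suc a))"
    by (simp add: uF_Echeck distrib_right left_diff_distrib scaleq_simps mult.assoc)
  also have "\<dots> = (q powi (- 2) * q powi (- 2 * (?a + 1)) * qint (?a + 2)) *\<^sub>q (?D (Suc (Suc a)) * uF)
      + (?k * (qint (?a + 1) * (q powi (- 2) * q powi (- 3 * ?a)) + q powi (- 4 * (?a + 1)))) *\<^sub>q (?D (Suc a) * ?x)
      - (?k * (qint (?a + 1) * (q powi (- 2) * q powi (- ?a)) + 1)) *\<^sub>q ?D (Suc a)"
    by (simp add: Suc x scaleq_simps distrib_left distrib_right right_diff_distrib E ED algebra_simps)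
  also have "q powi (- 2) * q powi (- 2 * (?a + 1)) = q powi (- 2 * (?a + 2))"
    by (rule q_powi_mult) simp
  also have "q powi (- 2) * q powi (- 3 * ?a) = q powi (- 3 * ?a - 2)"
    by (rule q_powi_mult) simp
  also have "q powi (- 2) * q powi (- ?a) = q powi (- ?a - 2)"
    by (rule q_powi_mult) simp
  also note qint_shift_identities(1)
  also note qint_shift_identities(2)
  finally have *: "qint (?a + 2) *\<^sub>q (uF * ?D (Suc (Suc a))) =
      qint (?a + 2) *\<^sub>q (q powi (- 2 * (?a + 2)) *\<^sub>q (?D (Suc (Suc a)) * uF)
      + ?k *\<^sub>q (?D (Suc a) * (q powi (- 3 * (?a + 1)) *\<^sub>q ?x - q powi (- (?a + 1)) *\<^sub>q 1)))"
    by (simp only: scaleq_simps right_diff_distrib mult_1_right)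
      (simp only: mult.assoc mult.commute mult.left_commute add_diff_eq)
  have nz: "qint (?a + 2) \<noteq> 0" by (simp add: qint_eq_0_iff)
  have "int (Suc a) + 1 = ?a + 2" "int (Suc a) = ?a + 1" by simp_all
  then show ?case by (simp only: scaleq_cancel[OF nz *])
qed

section \<open>Bracket elements and how F moves past them\<close>

lemma Kpow_commute: "Kpow m * Kpow n = Kpow n * Kpow m"
  by (metis Kpow_add add.commute)

text \<open>The numerator of the \<open>i\<close>-th factor of \<open>hbinom a n\<close> is
  \<open>hfactor (a + i - 1)\<close>.\<close>

definition hfactor :: "int \<Rightarrow> uq" where
  "hfactor a = q powi (4 * a) *\<^sub>q Kpow (- 2) - 1"

lemma hfactor_Kpow: "hfactor a * Kpow m = Kpow m * hfactor a"
  by (simp add: hfactor_def left_diff_distrib right_diff_distrib scaleq_simps Kpow_commute)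

lemma hfactor_commute: "hfactor a * hfactor b = hfactor b * hfactor a"
  unfolding hfactor_def[of b]
  by (simp add: left_diff_distrib right_diff_distrib scaleq_simps hfactor_Kpow)

text \<open>Moving F past K^-2 costs q^-4, which is exactly a shift of the index by one.\<close>

lemma uF_hfactor: "uF * hfactor a = hfactor (a - 1) * uF"
  by (simp add: hfactor_def left_diff_distrib right_diff_distrib scaleq_simps uF_Kpow q_nonzero
     flip: power_int_add)

lemma hbinom_0: "hbinom a 0 = 1"
  by (simp add: hbinom_def)

lemma hbinom_Suc: "hbinom a (Suc n) =
    (1 / (q powi (4 * (int n + 1)) - 1)) *\<^sub>q (hbinom a n * hfactor (a + int n))"
  by (simp add: hbinom_def hfactor_def scaleq_simps algebra_simps)

lemma hbinom_Kpow: "hbinom a n * Kpow m = Kpow m * hbinom a n"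
proof (induction n)
  case (Suc n)
  have "hbinom a n * hfactor (a + int n) * Kpow m = (hbinom a n * Kpow m) * hfactor (a + int n)"
    by (simp add: hfactor_Kpow mult.assoc)
  then show ?case by (simp add: Suc hbinom_Suc scaleq_simps mult.assoc)
qed (simp add: hbinom_0)

lemma uF_hbinom: "uF * hbinom a n = hbinom (a - 1) n * uF"
proof (induction n)
  case (Suc n)
  have "uF * (hbinom a n * hfactor (a + int n)) = hbinom (a - 1) n * hfactor (a - 1 + int n) * uF"
    by (metis Suc uF_hfactor mult.assoc add_diff_eq diff_add_eq)
  then show ?case by (simp add: hbinom_Suc scaleq_simps)
qed (simp add: hbinom_0)

text \<open>Splits off the first numerator factor, where \<open>hbinom_Suc\<close> splits off the
  last. Hence \<open>hbinom a (Suc n)\<close> and \<open>hbinom (a - 1) (Suc n)\<close> share the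
  factor \<open>hbinom a n\<close>, which makes brackets with neighbouring indices
  comparable.\<close>

lemma hbinom_Suc_left: "hbinom (a - 1) (Suc n) =
    (1 / (q powi (4 * (int n + 1)) - 1)) *\<^sub>q (hbinom a n * hfactor (a - 1))"
proof (induction n)
  case 0
  then show ?case by (simp add: hbinom_Suc hbinom_0)
next
  case (Suc n)
  have "hbinom (a - 1) (Suc (Suc n)) = (1 / (q powi (4 * (int (Suc n) + 1)) - 1)) *\<^sub>q
    (hbinom (a - 1) (Suc n) * hfactor (a + int n))"
    by (subst hbinom_Suc) (simp add: algebra_simps)
  also have "hbinom (a - 1) (Suc n) * hfactor (a + int n) = hbinom a (Suc n) * hfactor (a - 1)"
    by (simp add: Suc hbinom_Suc[of a] scaleq_simps mult.assoc hfactor_commute)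
  finally show ?case .
qed

text \<open>The middle factor is an arbitrary element so that the term is linear in it; in use it
  lies in the commutative subalgebra generated by the powers of K.\<close>

definition normal_term :: "ratfun \<Rightarrow> nat \<Rightarrow> uq \<Rightarrow> nat \<Rightarrow> uq" where
  "normal_term \<zeta> a h b = divpow (Echeck \<zeta>) a * h * divpow uF b"

lemma normal_term_linear:
  "normal_term \<zeta> a (h + h') b = normal_term \<zeta> a h b + normal_term \<zeta> a h' b"
  "normal_term \<zeta> a (h - h') b = normal_term \<zeta> a h b - normal_term \<zeta> a h' b"
  "normal_term \<zeta> a (s *\<^sub>q h) b = s *\<^sub>q normal_term \<zeta> a h b"
  by (simp_all add: normal_term_def algebra_simps scaleq_simps)

lemma Kpow_normal_term:
  "Kpow m * normal_term \<zeta> a h b = q powi (2 * m * int a) *\<^sub>q normal_term \<zeta> a (Kpow m * h) b"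
  by (simp add: normal_term_def Kpow_divpow_Echeck scaleq_mult_left flip: mult.assoc)

lemma Echeck_normal_term:
  "Echeck \<zeta> * normal_term \<zeta> a h b = qint (int a + 1) *\<^sub>q normal_term \<zeta> (Suc a) h b"
  using mult_divpow[of "Echeck \<zeta>" a]
  by (simp add: normal_term_def scaleq_simps add.commute flip: mult.assoc)

lemma uF_slide:
  "uF * (hbinom \<alpha> c * Kpow k) * divpow uF b =
    (q powi (2 * k) * qint (int b + 1)) *\<^sub>q (hbinom (\<alpha> - 1) c * Kpow k * divpow uF (Suc b))"
proof -
  have "uF * (hbinom \<alpha> c * Kpow k) * divpow uF b = hbinom (\<alpha> - 1) c * (uF * Kpow k) * divpow uF b"
    by (simp add: uF_hbinom flip: mult.assoc)
  also have "\<dots> = q powi (2 * k) *\<^sub>q (hbinom (\<alpha> - 1) c * Kpow k * (uF * divpow uF b))"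
    by (simp add: uF_Kpow scaleq_simps mult.assoc)
  finally show ?thesis
    by (simp add: mult_divpow scaleq_simps add.commute)
qed

text \<open>The first summand is F slid through to the right; the second comes from its commutator
  with the divided power of \<open>Echeck \<zeta>\<close>, which is missing when
  \<open>a = 0\<close>.\<close>

lemma uF_normal_term:
  "uF * normal_term \<zeta> a (hbinom \<alpha> c * Kpow k) b =
    (q powi (2 * k - 2 * int a) * qint (int b + 1)) *\<^sub>q normal_term \<zeta> a (hbinom (\<alpha> - 1) c * Kpow k) (Suc b)
   + (case a of 0 \<Rightarrow> 0 | Suc a' \<Rightarrow> (q * \<zeta> / (q ^ 2 - 1)) *\<^sub>q normal_term \<zeta> a'
       (hbinom \<alpha> c * (q powi (- 3 * int a') *\<^sub>q Kpow (- 2) - q powi (- int a') *\<^sub>q 1) * Kpow k) b)"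
proof (cases a)
  case 0
  then show ?thesis
    using uF_slide[of \<alpha> c k b] by (simp add: normal_term_def divpow_0 mult.assoc)
next
  case (Suc a')
  let ?g = "q powi (- 3 * int a') *\<^sub>q Kpow (- 2) - q powi (- int a') *\<^sub>q 1"
  have g: "?g * hbinom \<alpha> c = hbinom \<alpha> c * ?g"
    by (simp add: left_diff_distrib right_diff_distrib scaleq_simps hbinom_Kpow)
  have "uF * normal_term \<zeta> a (hbinom \<alpha> c * Kpow k) b
     = (uF * divpow (Echeck \<zeta>) (Suc a')) * (hbinom \<alpha> c * Kpow k) * divpow uF b"
    by (simp add: normal_term_def Suc mult.assoc)
  also have "\<dots> = q powi (- 2 * int a) *\<^sub>q (divpow (Echeck \<zeta>) a * (uF * (hbinom \<alpha> c * Kpow k) * divpow uF b))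
     + (q * \<zeta> / (q ^ 2 - 1)) *\<^sub>q (divpow (Echeck \<zeta>) a' * (?g * hbinom \<alpha> c) * Kpow k * divpow uF b)"
    by (simp only: uF_divpow_Echeck distrib_right scaleq_mult_left mult.assoc Suc of_nat_Suc add.commute)
  moreover have "q powi (2 * k - 2 * int a) = q powi (- 2 * int a) * q powi (2 * k)"
    by (simp add: q_nonzero flip: power_int_add)
  ultimately show ?thesis
    unfolding uF_slide g by (simp add: normal_term_def Suc scaleq_simps mult.assoc)
qed

section \<open>Scalar identities\<close>

text \<open>
  The following identities, with \<open>r = a + b + 2c\<close> and \<open>n = r + m - 1\<close>, express the passage from
  \<open>n\<close> to \<open>n + 1\<close>: \<open>constant\<close> and \<open>linear\<close> refer to the coefficients of \<open>1\<close> and of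
  \<open>K\<^sup>-\<^sup>2\<close>, the suffixes to the parities of \<open>n\<close> and of \<open>r\<close>.  The exponents
  \<open>4 - 2r\<close>, \<open>6 - 2r\<close>, \<open>8 - 2r\<close> are the values of \<open>4\<beta>\<close> for the index \<open>\<beta>\<close> of the common
  factor \<open>[h;\<beta>;c-1]\<close>.
\<close>

lemma q_powi_4_neq_1: "c > 0 \<Longrightarrow> (q powi c) ^ 4 \<noteq> 1"
  using q_powi_eq_1_iff[of "4 * c"] by (simp add: q_powi_numeral_mult)

context
  fixes a b c m :: int
  assumes c: "c > 0"
begin

lemma recursion_constant_even:
  "q powi (2 * c - 1) * qint (a + b + 2 * c + m) * (- 1 / (q powi (4 * c) - 1)) =
   q powi (4 * c - 1)
     * (qint m * q powi (b - a) * (- 1 / (q powi (4 * c) - 1))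
       + qint a * q powi (m + b) * (- 1 / (q powi (4 * c) - 1))
       + qint b * q powi (- a - m) * (- 1 / (q powi (4 * c) - 1)))
   - q powi (- m - b - a) / (q ^ 2 - 1)"
proof -
  define A B C M where "A = q powi a" "B = q powi b" "C = q powi c" "M = q powi m"
  have nz: "A \<noteq> 0" "B \<noteq> 0" "C \<noteq> 0" "M \<noteq> 0" "C ^ 4 - 1 \<noteq> 0" "q ^ 2 - 1 \<noteq> 0"
    using q_powi_4_neq_1[OF c] by (simp_all add: A_B_C_M_def q_nonzero q_square_neq_1)
  show ?thesis
    using nz
    by (simp add: powi_simps flip: A_B_C_M_def)
      (simp add: divide_simps q_nonzero, algebra)
qed

text \<open>The last term, absent for even \<open>n\<close>, stems from
  \<open>Bgen_idivpow1\<close>: only for an odd index does the product with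
  \<open>Bgen \<zeta>\<close> contain the divided power one below.\<close>

lemma recursion_constant_odd:
  "q powi (4 * c - 1) * qint (a + b + 2 * c + m) * (- 1 / (q powi (4 * c) - 1)) =
   q powi (2 * c - 1)
     * (qint m * q powi (b - a) * (- 1 / (q powi (4 * c) - 1))
       + qint a * q powi (m + b) * (- 1 / (q powi (4 * c) - 1))
       + qint b * q powi (- a - m) * (- 1 / (q powi (4 * c) - 1)))
   - q powi (2 - 2 * c) * q powi (- m - b - a) / (q ^ 2 - 1) - qint (a + b + 2 * c + m - 1)"
proof -
  define A B C M where "A = q powi a" "B = q powi b" "C = q powi c" "M = q powi m"
  have nz: "A \<noteq> 0" "B \<noteq> 0" "C \<noteq> 0" "M \<noteq> 0" "C ^ 4 - 1 \<noteq> 0" "q ^ 2 - 1 \<noteq> 0"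
    using q_powi_4_neq_1[OF c] by (simp_all add: A_B_C_M_def q_nonzero q_square_neq_1)
  show ?thesis
    using nz
    by (simp add: powi_simps flip: A_B_C_M_def)
      (simp add: divide_simps q_nonzero, algebra)
qed

lemma recursion_linear_even_even:
  "q powi (2 * c - 1) * qint (a + b + 2 * c + m)
       * (q powi (4 - 2 * (a + b + 2 * c) + 4 * c - 4) / (q powi (4 * c) - 1)) =
   q powi (4 * c - 1)
     * (qint m * q powi (b - a) * (q powi (4 - 2 * (a + b + 2 * c) + 4 * c - 4) / (q powi (4 * c) - 1))
       + qint a * q powi (m + b) * (q powi (4 - 2 * (a + b + 2 * c) + 4 * c - 4) / (q powi (4 * c) - 1))
       + qint b * q powi (- a - m) * (q powi (4 - 2 * (a + b + 2 * c) - 4) / (q powi (4 * c) - 1)))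
   + q powi (- m - b - 3 * a) / (q ^ 2 - 1)"
proof -
  define A B C M where "A = q powi a" "B = q powi b" "C = q powi c" "M = q powi m"
  have nz: "A \<noteq> 0" "B \<noteq> 0" "C \<noteq> 0" "M \<noteq> 0" "C ^ 4 - 1 \<noteq> 0" "q ^ 2 - 1 \<noteq> 0"
    using q_powi_4_neq_1[OF c] by (simp_all add: A_B_C_M_def q_nonzero q_square_neq_1)
  show ?thesis
    using nz
    by (simp add: powi_simps flip: A_B_C_M_def)
      (simp add: divide_simps q_nonzero, algebra)
qed

text \<open>The term with \<open>qint (m + 1)\<close> appears when \<open>n\<close> and
  \<open>r\<close> have opposite parities, that is, for even \<open>m\<close>: it is the share of
  the \<open>(m + 1)\<close>-st divided power that \<open>Bgen_idivpow1\<close> sends down to the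
  \<open>m\<close>-th.\<close>

lemma recursion_linear_even_odd:
  "q powi (2 * c - 1) * qint (a + b + 2 * c + m)
       * (q powi (6 - 2 * (a + b + 2 * c) + 4 * c - 4) / (q powi (4 * c) - 1)) =
   q powi (4 * c - 1)
     * (qint m * q powi (b - a) * (q powi (6 - 2 * (a + b + 2 * c) - 4) / (q powi (4 * c) - 1))
       + qint a * q powi (m + b) * (q powi (6 - 2 * (a + b + 2 * c) + 4 * c - 4) / (q powi (4 * c) - 1))
       + qint b * q powi (- a - m) * (q powi (6 - 2 * (a + b + 2 * c) - 4) / (q powi (4 * c) - 1)))
   + q powi (- m - b - 3 * a) / (q ^ 2 - 1) + qint (m + 1) * q powi (- 3 * a - b)"
proof -
  define A B C M where "A = q powi a" "B = q powi b" "C = q powi c" "M = q powi m"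
  have nz: "A \<noteq> 0" "B \<noteq> 0" "C \<noteq> 0" "M \<noteq> 0" "C ^ 4 - 1 \<noteq> 0" "q ^ 2 - 1 \<noteq> 0"
    using q_powi_4_neq_1[OF c] by (simp_all add: A_B_C_M_def q_nonzero q_square_neq_1)
  show ?thesis
    using nz
    by (simp add: powi_simps flip: A_B_C_M_def)
      (simp add: divide_simps q_nonzero, algebra)
qed

lemma recursion_linear_odd_even:
  "q powi (4 * c - 1) * qint (a + b + 2 * c + m)
       * (q powi (8 - 2 * (a + b + 2 * c) - 4) / (q powi (4 * c) - 1)) =
   q powi (2 * c - 1)
     * (qint m * q powi (b - a) * (q powi (8 - 2 * (a + b + 2 * c) - 4) / (q powi (4 * c) - 1))
       + qint a * q powi (m + b) * (q powi (8 - 2 * (a + b + 2 * c) + 4 * c - 4) / (q powi (4 * c) - 1))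
       + qint b * q powi (- a - m) * (q powi (8 - 2 * (a + b + 2 * c) - 4) / (q powi (4 * c) - 1)))
   + q powi (2 - 2 * c) * q powi (- m - b - 3 * a) / (q ^ 2 - 1)
   + q powi (2 - 2 * c) * qint (m + 1) * q powi (- 3 * a - b)"
proof -
  define A B C M where "A = q powi a" "B = q powi b" "C = q powi c" "M = q powi m"
  have nz: "A \<noteq> 0" "B \<noteq> 0" "C \<noteq> 0" "M \<noteq> 0" "C ^ 4 - 1 \<noteq> 0" "q ^ 2 - 1 \<noteq> 0"
    using q_powi_4_neq_1[OF c] by (simp_all add: A_B_C_M_def q_nonzero q_square_neq_1)
  show ?thesis
    using nz
    by (simp add: powi_simps flip: A_B_C_M_def)
      (simp add: divide_simps q_nonzero, algebra)
qed

lemma recursion_linear_odd_odd: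
  "q powi (4 * c - 1) * qint (a + b + 2 * c + m)
       * (q powi (6 - 2 * (a + b + 2 * c) - 4) / (q powi (4 * c) - 1)) =
   q powi (2 * c - 1)
     * (qint m * q powi (b - a) * (q powi (6 - 2 * (a + b + 2 * c) + 4 * c - 4) / (q powi (4 * c) - 1))
       + qint a * q powi (m + b) * (q powi (6 - 2 * (a + b + 2 * c) + 4 * c - 4) / (q powi (4 * c) - 1))
       + qint b * q powi (- a - m) * (q powi (6 - 2 * (a + b + 2 * c) - 4) / (q powi (4 * c) - 1)))
   + q powi (2 - 2 * c) * q powi (- m - b - 3 * a) / (q ^ 2 - 1)"
proof -
  define A B C M where "A = q powi a" "B = q powi b" "C = q powi c" "M = q powi m"
  have nz: "A \<noteq> 0" "B \<noteq> 0" "C \<noteq> 0" "M \<noteq> 0" "C ^ 4 - 1 \<noteq> 0" "q ^ 2 - 1 \<noteq> 0"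
    using q_powi_4_neq_1[OF c] by (simp_all add: A_B_C_M_def q_nonzero q_square_neq_1)
  show ?thesis
    using nz
    by (simp add: powi_simps flip: A_B_C_M_def)
      (simp add: divide_simps q_nonzero, algebra)
qed

end

section \<open>The second tensor factors\<close>

text \<open>The degree \<open>r\<close> is an integer so that the set is empty for negative
  \<open>r\<close> and the shifts to \<open>r - 1\<close> and \<open>r - 2\<close> need no case
  distinction.\<close>

definition triples :: "int \<Rightarrow> (nat \<times> nat \<times> nat) set" where
  "triples r = {(a, b, c). int a + int b + 2 * int c = r}"

lemma finite_triples: "finite (triples r)"
proof (rule finite_subset)
  show "triples r \<subseteq> {..nat r} \<times> {..nat r} \<times> {..nat r}"
    by (auto simp: triples_def)
qed simp

lemma sum_reindex_neutral:
  assumes "finite B" "inj_on f A" "f ` A \<subseteq> B" "\<And>x. x \<in> A \<Longrightarrow> g x = h (f x)"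
    "\<And>y. y \<in> B \<Longrightarrow> y \<notin> f ` A \<Longrightarrow> h y = 0"
  shows "sum g A = sum h B"
proof -
  have "sum g A = sum h (f ` A)" using assms(2,4) by (simp add: sum.reindex)
  also have "\<dots> = sum h B" using assms by (intro sum.mono_neutral_left) auto
  finally show ?thesis .
qed

text \<open>The shift misses only triples with \<open>a = 0\<close>, where the summand vanishes; in
  the applications this is due to \<open>qint 0\<close> or to the zero branch of a case
  expression.\<close>

lemma sum_triples_shift_left:
  assumes "\<And>b c. h 0 b c = 0" "\<And>a b c. g a b c = h (Suc a) b c"
  shows "(\<Sum>(a, b, c)\<in>triples (r - 1). g a b c) = (\<Sum>(a, b, c)\<in>triples r. h a b c)"
proof (rule sum_reindex_neutral[where f = "\<lambda>(a, b, c). (Suc a, b, c)"])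
  fix y assume y: "y \<in> triples r" "y \<notin> (\<lambda>(a, b, c). (Suc a, b, c)) ` triples (r - 1)"
  obtain a b c where abc: "y = (a, b, c)" by (cases y)
  have "a = 0"
  proof (cases a)
    case (Suc a')
    then have "y = (\<lambda>(a, b, c). (Suc a, b, c)) (a', b, c)" "(a', b, c) \<in> triples (r - 1)"
      using y(1) abc by (auto simp: triples_def)
    then show ?thesis using y(2) by blast
  qed simp
  then show "(case y of (a, b, c) \<Rightarrow> h a b c) = 0" using assms(1) abc by simp
qed (auto simp: assms(2) inj_on_def triples_def intro: finite_triples[unfolded triples_def])

lemma sum_triples_shift_mid:
  assumes "\<And>a c. h a 0 c = 0" "\<And>a b c. g a b c = h a (Suc b) c"
  shows "(\<Sum>(a, b, c)\<in>triples (r - 1). g a b c) = (\<Sum>(a, b, c)\<in>triples r. h a b c)"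
proof (rule sum_reindex_neutral[where f = "\<lambda>(a, b, c). (a, Suc b, c)"])
  fix y assume y: "y \<in> triples r" "y \<notin> (\<lambda>(a, b, c). (a, Suc b, c)) ` triples (r - 1)"
  obtain a b c where abc: "y = (a, b, c)" by (cases y)
  have "b = 0"
  proof (cases b)
    case (Suc b')
    then have "y = (\<lambda>(a, b, c). (a, Suc b, c)) (a, b', c)" "(a, b', c) \<in> triples (r - 1)"
      using y(1) abc by (auto simp: triples_def)
    then show ?thesis using y(2) by blast
  qed simp
  then show "(case y of (a, b, c) \<Rightarrow> h a b c) = 0" using assms(1) abc by simp
qed (auto simp: assms(2) inj_on_def triples_def intro: finite_triples[unfolded triples_def])

lemma sum_triples_shift_right:
  "(\<Sum>(a, b, c)\<in>triples (r - 2). g a b c) =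
   (\<Sum>(a, b, c)\<in>triples r. case c of 0 \<Rightarrow> 0 | Suc c' \<Rightarrow> g a b c')"
proof (rule sum_reindex_neutral[where f = "\<lambda>(a, b, c). (a, b, Suc c)"])
  fix y assume y: "y \<in> triples r" "y \<notin> (\<lambda>(a, b, c). (a, b, Suc c)) ` triples (r - 2)"
  obtain a b c where abc: "y = (a, b, c)" by (cases y)
  have "c = 0"
  proof (cases c)
    case (Suc c')
    then have "y = (\<lambda>(a, b, c). (a, b, Suc c)) (a, b, c')" "(a, b, c') \<in> triples (r - 2)"
      using y(1) abc by (auto simp: triples_def)
    then show ?thesis using y(2) by blast
  qed simp
  then show "(case y of (a, b, c) \<Rightarrow> (case c of 0 \<Rightarrow> 0 | Suc c' \<Rightarrow> g a b c')) = 0"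
    using abc by simp
qed (auto simp: inj_on_def triples_def intro: finite_triples[unfolded triples_def])

text \<open>Integer closed forms of the binomial coefficients in the exponents of the theorem, the
  first for even and the second for odd \<open>n\<close>.\<close>

definition weight :: "bool \<Rightarrow> nat \<Rightarrow> int" where
  "weight p c = int c * (2 * int c + (if p then 1 else - 1))"

text \<open>Integer \<open>div\<close> rounds down, so the floors of the theorem are met also for
  negative numerators, as at \<open>r = 0\<close>.\<close>

definition hindex :: "bool \<Rightarrow> int \<Rightarrow> int" where
  "hindex p r = - ((r - (if p then 1 else 2)) div 2)"

text \<open>The exponent of the theorem with \<open>b = r - 2 * c - a\<close> and
  \<open>m = n - r\<close>. Integer \<open>a\<close> and \<open>b\<close> admit shifts to
  \<open>a - 1\<close> and \<open>b - 1\<close>; at zero these meet a factor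
  \<open>qint 0\<close>.\<close>

definition coef :: "ratfun \<Rightarrow> bool \<Rightarrow> int \<Rightarrow> int \<Rightarrow> nat \<Rightarrow> int \<Rightarrow> ratfun" where
  "coef \<zeta> p a b c m = q powi (weight p c - (a + b) * m - a * b) * (q * \<zeta>) ^ c"

text \<open>
  The second factor belonging to the \<open>m\<close>-th divided power in the coproduct of the \<open>(r + m)\<close>-th
  one; \<open>p\<close> says whether \<open>r + m\<close> is even.  Integer \<open>r\<close> makes it vanish for \<open>r < 0\<close>, so that no
  boundary cases arise.
\<close>

definition component :: "ratfun \<Rightarrow> bool \<Rightarrow> int \<Rightarrow> int \<Rightarrow> uq" where
  "component \<zeta> p r m = (\<Sum>(a, b, c)\<in>triples r.
     coef \<zeta> p (int a) (int b) c m *\<^sub>q normal_term \<zeta> a (hbinom (hindex p r) c * Kpow (- m)) b)"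

lemma component_negative: "r < 0 \<Longrightarrow> component \<zeta> p r m = 0"
  unfolding component_def by (rule sum.neutral) (auto simp: triples_def)

text \<open>Comparisons of exponents that bring every term of the recursion to the common
  coefficient at \<open>a\<close>, \<open>b\<close>, \<open>c\<close>, \<open>m\<close>.\<close>

lemma coef_shift:
  "coef \<zeta> p a b c (m - 1) * q powi (- 2 * a) = coef \<zeta> p a b c m * q powi (b - a)"
  "coef \<zeta> p (a - 1) b c m = coef \<zeta> p a b c m * q powi (m + b)"
  "coef \<zeta> p a (b - 1) c m * q powi (- 2 * m - 2 * a) = coef \<zeta> p a b c m * q powi (- a - m)"
  "coef \<zeta> p (a + 1) b c m = coef \<zeta> p a b c m * q powi (- m - b)"
  "coef \<zeta> p a b c (m + 1) * q powi (- 2 * a) = coef \<zeta> p a b c m * q powi (- 3 * a - b)"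
proof -
  have *: "q powi i * t * q powi j = q powi k * t * q powi l" if "i + j = k + l" for i j k l t
    using q_powi_mult[OF that] by (simp add: power_int_add q_nonzero mult.assoc mult.left_commute mult.commute)
  have **: "q powi i * t = q powi k * t * q powi l" if "i = k + l" for i k l t
    using *[of i 0 k l t] that by simp
  show "coef \<zeta> p a b c (m - 1) * q powi (- 2 * a) = coef \<zeta> p a b c m * q powi (b - a)"
    unfolding coef_def by (rule *) (simp add: algebra_simps)
  show "coef \<zeta> p (a - 1) b c m = coef \<zeta> p a b c m * q powi (m + b)"
    unfolding coef_def by (rule **) (simp add: algebra_simps)
  show "coef \<zeta> p a (b - 1) c m * q powi (- 2 * m - 2 * a) = coef \<zeta> p a b c m * q powi (- a - m)"
    unfolding coef_def by (rule *) (simp add: algebra_simps)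
  show "coef \<zeta> p (a + 1) b c m = coef \<zeta> p a b c m * q powi (- m - b)"
    unfolding coef_def by (rule **) (simp add: algebra_simps)
  show "coef \<zeta> p a b c (m + 1) * q powi (- 2 * a) = coef \<zeta> p a b c m * q powi (- 3 * a - b)"
    unfolding coef_def by (rule *) (simp add: algebra_simps)
qed

text \<open>The coefficient for \<open>True\<close> and \<open>d\<close> serves as reference; the
  powers of \<open>q\<close> are the differences of weights, written with \<open>d + 1\<close>
  because that is the \<open>c\<close> of the scalar identities.\<close>

lemma coef_Suc:
  "coef \<zeta> True a b (Suc d) m = coef \<zeta> True a b d m * (q * \<zeta>) * q powi (4 * (int d + 1) - 1)"
  "coef \<zeta> False a b (Suc d) m = coef \<zeta> True a b d m * (q * \<zeta>) * q powi (2 * (int d + 1) - 1)"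
  "coef \<zeta> False a b d m = coef \<zeta> True a b d m * q powi (2 - 2 * (int d + 1))"
proof -
  have *: "q powi i * t ^ Suc d = q powi k * t ^ d * t * q powi l" if "i = k + l" for i k l t
    using that by (simp add: power_int_add q_nonzero)
  have **: "q powi i * t = q powi k * t * q powi l" if "i = k + l" for i k l t
    using that by (simp add: power_int_add q_nonzero)
  show "coef \<zeta> True a b (Suc d) m = coef \<zeta> True a b d m * (q * \<zeta>) * q powi (4 * (int d + 1) - 1)"
    unfolding coef_def weight_def by (rule *) (simp add: algebra_simps)
  show "coef \<zeta> False a b (Suc d) m = coef \<zeta> True a b d m * (q * \<zeta>) * q powi (2 * (int d + 1) - 1)"
    unfolding coef_def weight_def by (rule *) (simp add: algebra_simps)
  show "coef \<zeta> False a b d m = coef \<zeta> True a b d m * q powi (2 - 2 * (int d + 1))"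
    unfolding coef_def weight_def by (rule **) (simp add: algebra_simps)
qed

section \<open>The action of K^-1, \<open>Echeck \<zeta>\<close> and F on the components\<close>

lemma Kpow_slot: "Kpow (- 1) * (hbinom \<alpha> c * Kpow k) = hbinom \<alpha> c * Kpow (k - 1)"
proof -
  have "Kpow (- 1) * (hbinom \<alpha> c * Kpow k) = hbinom \<alpha> c * (Kpow (- 1) * Kpow k)"
    by (metis hbinom_Kpow mult.assoc)
  then show ?thesis by (simp flip: Kpow_add)
qed

lemma Kpow_component:
  "Kpow (- 1) * component \<zeta> p r m = (\<Sum>(a, b, c)\<in>triples r.
     (coef \<zeta> p (int a) (int b) c m * q powi (- 2 * int a)) *\<^sub>q
       normal_term \<zeta> a (hbinom (hindex p r) c * Kpow (- m - 1)) b)"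
  unfolding component_def sum_distrib_left
  by (intro sum.cong refl) (auto simp: scaleq_simps Kpow_normal_term Kpow_slot)

lemma Echeck_component:
  "Echeck \<zeta> * component \<zeta> p (r - 1) m = (\<Sum>(a, b, c)\<in>triples r.
     (coef \<zeta> p (int a - 1) (int b) c m * qint (int a)) *\<^sub>q
       normal_term \<zeta> a (hbinom (hindex p (r - 1)) c * Kpow (- m)) b)"
proof -
  let ?h = "\<lambda>c. hbinom (hindex p (r - 1)) c * Kpow (- m)"
  have "Echeck \<zeta> * component \<zeta> p (r - 1) m = (\<Sum>(a, b, c)\<in>triples (r - 1).
      (coef \<zeta> p (int a) (int b) c m * qint (int a + 1)) *\<^sub>q normal_term \<zeta> (Suc a) (?h c) b)"
    unfolding component_def sum_distrib_left
    by (intro sum.cong refl) (auto simp: scaleq_simps Echeck_normal_term)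
  also have "\<dots> = (\<Sum>(a, b, c)\<in>triples r.
      (coef \<zeta> p (int a - 1) (int b) c m * qint (int a)) *\<^sub>q normal_term \<zeta> a (?h c) b)"
    by (rule sum_triples_shift_left) (simp_all add: qint_0 scaleq_zero_left add.commute)
  finally show ?thesis .
qed

text \<open>F either raises \<open>b\<close>, or its commutator lowers \<open>a\<close>. The latter
  takes degree \<open>r - 1\<close> to \<open>r - 2\<close>, and raising \<open>c\<close> brings the
  sum back to \<open>triples r\<close>.\<close>

lemma uF_component:
  "uF * component \<zeta> p (r - 1) m = (\<Sum>(a, b, c)\<in>triples r.
     (coef \<zeta> p (int a) (int b - 1) c m * q powi (- 2 * m - 2 * int a) * qint (int b)) *\<^sub>q
       normal_term \<zeta> a (hbinom (hindex p (r - 1) - 1) c * Kpow (- m)) b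
   + (case c of 0 \<Rightarrow> 0 | Suc d \<Rightarrow> (coef \<zeta> p (int a + 1) (int b) d m * (q * \<zeta> / (q ^ 2 - 1))) *\<^sub>q
       normal_term \<zeta> a (hbinom (hindex p (r - 1)) d
         * (q powi (- 3 * int a) *\<^sub>q Kpow (- 2) - q powi (- int a) *\<^sub>q 1) * Kpow (- m)) b))"
proof -
  let ?A = "\<lambda>a b c. (coef \<zeta> p (int a) (int b) c m * q powi (- 2 * m - 2 * int a) * qint (int b + 1)) *\<^sub>q
       normal_term \<zeta> a (hbinom (hindex p (r - 1) - 1) c * Kpow (- m)) (Suc b)"
  let ?B = "\<lambda>a b c. (coef \<zeta> p (int a + 1) (int b) c m * (q * \<zeta> / (q ^ 2 - 1))) *\<^sub>q
       normal_term \<zeta> a (hbinom (hindex p (r - 1)) c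
         * (q powi (- 3 * int a) *\<^sub>q Kpow (- 2) - q powi (- int a) *\<^sub>q 1) * Kpow (- m)) b"
  have "uF * component \<zeta> p (r - 1) m = (\<Sum>(a, b, c)\<in>triples (r - 1).
      ?A a b c + (case a of 0 \<Rightarrow> 0 | Suc a' \<Rightarrow> ?B a' b c))"
    unfolding component_def sum_distrib_left
    by (intro sum.cong refl)
      (auto simp: scaleq_mult_right uF_normal_term scaleq_add_right scaleq_scaleq mult.assoc
         scaleq_zero_right add.commute split: nat.split)
  also have "\<dots> = (\<Sum>(a, b, c)\<in>triples (r - 1). ?A a b c)
      + (\<Sum>(a, b, c)\<in>triples (r - 1). case a of 0 \<Rightarrow> 0 | Suc a' \<Rightarrow> ?B a' b c)"
    by (simp add: case_prod_beta sum.distrib)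
  also have "(\<Sum>(a, b, c)\<in>triples (r - 1). ?A a b c) = (\<Sum>(a, b, c)\<in>triples r.
     (coef \<zeta> p (int a) (int b - 1) c m * q powi (- 2 * m - 2 * int a) * qint (int b)) *\<^sub>q
       normal_term \<zeta> a (hbinom (hindex p (r - 1) - 1) c * Kpow (- m)) b)"
    by (rule sum_triples_shift_mid) (simp_all add: qint_0 scaleq_zero_left add.commute)
  also have "(\<Sum>(a, b, c)\<in>triples (r - 1). case a of 0 \<Rightarrow> 0 | Suc a' \<Rightarrow> ?B a' b c)
     = (\<Sum>(a, b, c)\<in>triples (r - 2). ?B a b c)"
    using sum_triples_shift_left[of "\<lambda>a b c. case a of 0 \<Rightarrow> 0 | Suc a' \<Rightarrow> ?B a' b c" ?B "r - 1"]
    by simp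
  also have "\<dots> = (\<Sum>(a, b, c)\<in>triples r. case c of 0 \<Rightarrow> 0 | Suc d \<Rightarrow> ?B a b d)"
    by (rule sum_triples_shift_right)
  finally show ?thesis
    unfolding sum.distrib[symmetric] by (rule trans) (rule sum.cong, auto split: nat.split)
qed

section \<open>Recursion for the second tensor factors\<close>

text \<open>One expansion splits off the last numerator factor, the other the first, so both rest on
  \<open>hbinom \<beta> d\<close>. The parameter \<open>j\<close> gives the exponents the form they
  have in the scalar identities.\<close>

lemma hbinom_term_expand:
  assumes "4 * \<beta> = j"
  shows "normal_term \<zeta> a (hbinom \<beta> (Suc d) * h) b =
      (- 1 / (q powi (4 * (int d + 1)) - 1)) *\<^sub>q normal_term \<zeta> a (hbinom \<beta> d * h) b
    + (q powi (j + 4 * (int d + 1) - 4) / (q powi (4 * (int d + 1)) - 1)) *\<^sub>q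
        normal_term \<zeta> a (hbinom \<beta> d * (Kpow (- 2) * h)) b"
    and "normal_term \<zeta> a (hbinom (\<beta> - 1) (Suc d) * h) b =
      (- 1 / (q powi (4 * (int d + 1)) - 1)) *\<^sub>q normal_term \<zeta> a (hbinom \<beta> d * h) b
    + (q powi (j - 4) / (q powi (4 * (int d + 1)) - 1)) *\<^sub>q
        normal_term \<zeta> a (hbinom \<beta> d * (Kpow (- 2) * h)) b"
proof -
  have e: "j + 4 * (int d + 1) - 4 = 4 * (\<beta> + int d)" "j - 4 = 4 * (\<beta> - 1)"
    using assms by simp_all
  show "normal_term \<zeta> a (hbinom \<beta> (Suc d) * h) b =
      (- 1 / (q powi (4 * (int d + 1)) - 1)) *\<^sub>q normal_term \<zeta> a (hbinom \<beta> d * h) b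
    + (q powi (j + 4 * (int d + 1) - 4) / (q powi (4 * (int d + 1)) - 1)) *\<^sub>q
        normal_term \<zeta> a (hbinom \<beta> d * (Kpow (- 2) * h)) b"
    unfolding e hbinom_Suc hfactor_def
    by (simp add: scaleq_simps mult.assoc left_diff_distrib right_diff_distrib normal_term_linear)
  show "normal_term \<zeta> a (hbinom (\<beta> - 1) (Suc d) * h) b =
      (- 1 / (q powi (4 * (int d + 1)) - 1)) *\<^sub>q normal_term \<zeta> a (hbinom \<beta> d * h) b
    + (q powi (j - 4) / (q powi (4 * (int d + 1)) - 1)) *\<^sub>q
        normal_term \<zeta> a (hbinom \<beta> d * (Kpow (- 2) * h)) b"
    unfolding e hbinom_Suc_left hfactor_def
    by (simp add: scaleq_simps mult.assoc left_diff_distrib right_diff_distrib normal_term_linear)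
qed

lemma recursion_c_0:
  fixes a b m :: int
  shows "qint (a + b + m) = qint m * q powi (b - a) + qint a * q powi (m + b) + qint b * q powi (- a - m)"
proof -
  define A B M where "A = q powi a" "B = q powi b" "M = q powi m"
  have nz: "A \<noteq> 0" "B \<noteq> 0" "M \<noteq> 0" "q ^ 2 - 1 \<noteq> 0"
    by (simp_all add: A_B_M_def q_nonzero q_square_neq_1)
  show ?thesis
    using nz
    by (simp add: powi_simps flip: A_B_M_def)
      (simp add: divide_simps q_nonzero, algebra)
qed

text \<open>Comparison of coefficients: assumption \<open>u\<close> settles that of
  \<open>X\<close>, assumption \<open>v\<close> that of \<open>Y\<close>. In use \<open>X\<close> is
  the term with the common bracket and \<open>Y\<close> the same term with an additional
  K^-2.\<close>

lemma linear_assembly: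
  fixes X Y :: "'a::qalgebra"
  assumes u: "wL * n * u = w * (M * P1 * u + A * P2 * u + B * P3 * u) - w1 * (P4 * t1) * e - n6"
    and v: "wL * n * vL = w * (M * P1 * v1 + A * P2 * v0 + B * P3 * vF) + w1 * (P4 * t3) * e + w1 * m5 * P5"
  shows "(n * (k * z * wL)) *\<^sub>q (u *\<^sub>q X + vL *\<^sub>q Y) =
     (M * (k * z * w * P1)) *\<^sub>q (u *\<^sub>q X + v1 *\<^sub>q Y)
   + (k * z * w * P2 * A) *\<^sub>q (u *\<^sub>q X + v0 *\<^sub>q Y)
   + (k * z * w * P3 * B) *\<^sub>q (u *\<^sub>q X + vF *\<^sub>q Y)
   + (k * w1 * P4 * (z * e)) *\<^sub>q (t3 *\<^sub>q Y - t1 *\<^sub>q X)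
   + (z * m5 * (k * w1 * P5)) *\<^sub>q Y
   - (z * n6 * k) *\<^sub>q X"
proof -
  have "(n * (k * z * wL)) *\<^sub>q (u *\<^sub>q X + vL *\<^sub>q Y)
      = (k * z * (wL * n * u)) *\<^sub>q X + (k * z * (wL * n * vL)) *\<^sub>q Y"
    by (simp add: scaleq_simps mult_ac)
  also have "\<dots> = (k * z * (w * (M * P1 * u + A * P2 * u + B * P3 * u) - w1 * (P4 * t1) * e - n6)) *\<^sub>q X
      + (k * z * (w * (M * P1 * v1 + A * P2 * v0 + B * P3 * vF) + w1 * (P4 * t3) * e + w1 * m5 * P5)) *\<^sub>q Y"
    by (simp only: u v)
  finally show ?thesis
    by (simp add: scaleq_simps distrib_left right_diff_distrib mult_ac)
qed

text \<open>The six terms on the right come, in order, from K^-1 with the upward part of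
  \<open>Bgen_idivpow1\<close>, from \<open>Echeck \<zeta>\<close>, from F sliding through, from the
  commutator of F, from K^-1 with the downward part, and from the subtracted lower divided
  power.\<close>

lemma component_summand_recursion_Suc:
  fixes \<zeta> :: ratfun and a b d :: nat and m r :: int and p :: bool
  assumes r: "r = int a + int b + 2 * (int d + 1)" and p: "p \<longleftrightarrow> even (r + m - 1)"
  defines "H \<equiv> \<lambda>\<alpha> c. normal_term \<zeta> a (hbinom \<alpha> c * Kpow (- m)) b"
  shows "(qint (r + m) * coef \<zeta> (\<not> p) (int a) (int b) (Suc d) m) *\<^sub>q H (hindex (\<not> p) r) (Suc d) =
     (qint m * (coef \<zeta> p (int a) (int b) (Suc d) (m - 1) * q powi (- 2 * int a))) *\<^sub>q
       H (hindex p r) (Suc d)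
   + (coef \<zeta> p (int a - 1) (int b) (Suc d) m * qint (int a)) *\<^sub>q H (hindex p (r - 1)) (Suc d)
   + (coef \<zeta> p (int a) (int b - 1) (Suc d) m * q powi (- 2 * m - 2 * int a) * qint (int b)) *\<^sub>q
       H (hindex p (r - 1) - 1) (Suc d)
   + (coef \<zeta> p (int a + 1) (int b) d m * (q * \<zeta> / (q ^ 2 - 1))) *\<^sub>q
       normal_term \<zeta> a (hbinom (hindex p (r - 1)) d
         * (q powi (- 3 * int a) *\<^sub>q Kpow (- 2) - q powi (- int a) *\<^sub>q 1) * Kpow (- m)) b
   + (q * \<zeta> * (if even m then qint (m + 1) else 0)
         * (coef \<zeta> p (int a) (int b) d (m + 1) * q powi (- 2 * int a))) *\<^sub>q
       normal_term \<zeta> a (hbinom (hindex p (r - 2)) d * Kpow (- (m + 1) - 1)) b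
   - (q * \<zeta> * (if p then 0 else qint (r + m - 1)) * coef \<zeta> True (int a) (int b) d m) *\<^sub>q
       H (hindex True (r - 2)) d"
    (is "?goal")
proof -
  define c where "c = int d + 1"
  have c: "c > 0" by (simp add: c_def)
  define k where "k = coef \<zeta> True (int a) (int b) d m"
  define w where "w p' = (if p' then q powi (4 * c - 1) else q powi (2 * c - 1))" for p'
  define w1 where "w1 = (if p then 1 else q powi (2 - 2 * c))"
  define Y where "Y \<beta> = normal_term \<zeta> a (hbinom \<beta> d * (Kpow (- 2) * Kpow (- m))) b" for \<beta>
  define u where "u = - 1 / (q powi (4 * c) - 1)"
  define v0 where "v0 j = q powi (j + 4 * c - 4) / (q powi (4 * c) - 1)" for j
  define v1 where "v1 j = q powi (j - 4) / (q powi (4 * c) - 1)" for j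
  \<comment> \<open>\<open>J i\<close> is \<open>i - 2 * r\<close>; suitable \<open>i\<close> give 4
    times the index of the common bracket.\<close>
  define J :: "int \<Rightarrow> int" where "J i = i - 2 * (int a + int b + 2 * c)" for i
  have K2: "Kpow (- (m + 1) - 1) = Kpow (- 2) * Kpow (- m)"
    by (simp flip: Kpow_add)
  have bracket: "normal_term \<zeta> a (hbinom \<alpha> d
         * (q powi (- 3 * int a) *\<^sub>q Kpow (- 2) - q powi (- int a) *\<^sub>q 1) * Kpow (- m)) b
       = q powi (- 3 * int a) *\<^sub>q Y \<alpha> - q powi (- int a) *\<^sub>q H \<alpha> d" for \<alpha>
    by (simp add: H_def Y_def scaleq_simps left_diff_distrib right_diff_distrib mult.assoc
        normal_term_linear)
  have H0: "H \<beta> (Suc d) = u *\<^sub>q H \<beta> d + v0 j *\<^sub>q Y \<beta>"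
    and H1: "H (\<beta> - 1) (Suc d) = u *\<^sub>q H \<beta> d + v1 j *\<^sub>q Y \<beta>" if "4 * \<beta> = j" for \<beta> j
    unfolding H_def Y_def c_def u_def v0_def v1_def by (fact hbinom_term_expand[OF that])+
  have coef_k: "coef \<zeta> p' (int a) (int b) (Suc d) m = k * (q * \<zeta>) * w p'" for p'
    unfolding k_def c_def w_def by (cases p') (simp_all only: coef_Suc(1,2) if_True if_False)
  have coef_k1: "coef \<zeta> p (int a) (int b) d m = k * w1"
    unfolding k_def c_def w1_def by (cases p) (simp_all only: coef_Suc(3) if_True if_False mult_1_right)
  have mono: "q powi (- m - int b) * q powi (- 3 * int a) = q powi (- m - int b - 3 * int a)"
    "q powi (- m - int b) * q powi (- int a) = q powi (- m - int b - int a)"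
    by (rule q_powi_mult, simp)+
  have r': "r + m = int a + int b + 2 * c + m" "r + m - 1 = int a + int b + 2 * c + m - 1"
    by (simp_all add: r c_def)
  have U: "w (\<not> p) * qint (r + m) * u = w p * (qint m * q powi (int b - int a) * u
      + qint (int a) * q powi (m + int b) * u + qint (int b) * q powi (- int a - m) * u)
      - w1 * (q powi (- m - int b) * q powi (- int a)) * (1 / (q ^ 2 - 1))
      - (if p then 0 else qint (r + m - 1))"
    unfolding mono r' w_def w1_def u_def
    using recursion_constant_even[OF c, of "int a" "int b" m]
      recursion_constant_odd[OF c, of "int a" "int b" m]
    by simp
  \<comment> \<open>The argument common to all parities. The coefficients \<open>vL\<close> and
    \<open>vP\<close> of K^-2, on the left and in the first term on the right, will be
    \<open>v0 j\<close> or \<open>v1 j\<close> according to whether the bracket there has index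
    \<open>\<beta>\<close> or \<open>\<beta> - 1\<close>. \<open>h5\<close> and \<open>h6\<close>
    are conditional because the terms concerned otherwise have coefficient zero.\<close>
  have main: ?goal if "4 * \<beta> = j"
    and hL: "H (hindex (\<not> p) r) (Suc d) = u *\<^sub>q H \<beta> d + vL *\<^sub>q Y \<beta>"
    and h1: "H (hindex p r) (Suc d) = u *\<^sub>q H \<beta> d + vP *\<^sub>q Y \<beta>"
    and h2: "hindex p (r - 1) = \<beta>"
    and h5: "even m \<Longrightarrow> hindex p (r - 2) = \<beta>"
    and h6: "\<not> p \<Longrightarrow> hindex True (r - 2) = \<beta>"
    and V: "w (\<not> p) * qint (r + m) * vL = w p * (qint m * q powi (int b - int a) * vP
      + qint (int a) * q powi (m + int b) * v0 j + qint (int b) * q powi (- int a - m) * v1 j)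
      + w1 * q powi (- m - int b - 3 * int a) * (1 / (q ^ 2 - 1))
      + w1 * (if even m then qint (m + 1) else 0) * q powi (- 3 * int a - int b)"
    for \<beta> j vL vP
  proof -
    have Y5: "(q * \<zeta> * (if even m then qint (m + 1) else 0) * t) *\<^sub>q Y (hindex p (r - 2))
      = (q * \<zeta> * (if even m then qint (m + 1) else 0) * t) *\<^sub>q Y \<beta>" for t
      using h5 by (simp add: scaleq_zero_left)
    have X6: "(q * \<zeta> * (if p then 0 else qint (r + m - 1)) * t) *\<^sub>q H (hindex True (r - 2)) d
      = (q * \<zeta> * (if p then 0 else qint (r + m - 1)) * t) *\<^sub>q H \<beta> d" for t
      using h6 by (simp add: scaleq_zero_left)
    have e: "q * \<zeta> / (q ^ 2 - 1) = q * \<zeta> * (1 / (q ^ 2 - 1))" by simp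
    show ?thesis
      unfolding bracket K2 Y_def[symmetric] coef_shift hL h1 h2 coef_k coef_k1
        H0[OF that(1)] H1[OF that(1)] Y5 X6 k_def[symmetric] e
      by (rule linear_assembly[OF U V[folded mono]])
  qed
  note V_unfold = r' w_def w1_def v0_def v1_def J_def
  \<comment> \<open>The parity of \<open>m\<close> follows from those of \<open>r + m - 1\<close>
    and of \<open>r\<close>, which the two letters name in this order.\<close>
  consider (ee) s where "p" "odd m" "r = 2 * s" | (eo) s where "p" "even m" "r = 2 * s + 1"
    | (oe) s where "\<not> p" "even m" "r = 2 * s" | (oo) s where "\<not> p" "odd m" "r = 2 * s + 1"
    using p by (cases "even r"; cases "even m") (auto elim!: evenE oddE)
  then show ?thesis
  proof cases
    case (ee s)
    have j: "4 * (1 - s) = J 4"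
      using ee(3) r by (simp add: J_def c_def)
    have h: "hindex False r = 1 - s" "hindex True r = 1 - s" "hindex True (r - 1) = 1 - s"
      unfolding hindex_def ee(3) by simp_all
    show ?thesis
    proof (rule main[OF j])
      show "H (hindex (\<not> p) r) (Suc d) = u *\<^sub>q H (1 - s) d + v0 (J 4) *\<^sub>q Y (1 - s)"
        "H (hindex p r) (Suc d) = u *\<^sub>q H (1 - s) d + v0 (J 4) *\<^sub>q Y (1 - s)"
        using ee(1) H0[OF j] by (simp_all add: h)
    qed (use ee(1,2) recursion_linear_even_even[OF c, of "int a" "int b" m] in \<open>simp_all add: h V_unfold\<close>)
  next
    case (eo s)
    have j: "4 * (1 - s) = J 6"
      using eo(3) r by (simp add: J_def c_def)
    have h: "hindex False r = 1 - s" "hindex True r = 1 - s - 1" "hindex True (r - 1) = 1 - s"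
      "hindex True (r - 2) = 1 - s"
      unfolding hindex_def eo(3) by simp_all
    show ?thesis
    proof (rule main[OF j])
      show "H (hindex (\<not> p) r) (Suc d) = u *\<^sub>q H (1 - s) d + v0 (J 6) *\<^sub>q Y (1 - s)"
        "H (hindex p r) (Suc d) = u *\<^sub>q H (1 - s) d + v1 (J 6) *\<^sub>q Y (1 - s)"
        using eo(1) H0[OF j] H1[OF j] by (simp_all only: h not_True_eq_False simp_thms)
    qed (use eo(1,2) recursion_linear_even_odd[OF c, of "int a" "int b" m] in \<open>simp_all add: h V_unfold\<close>)
  next
    case (oe s)
    \<comment> \<open>Here the brackets for \<open>r\<close> have index \<open>1 - s\<close>, while
      those for \<open>r - 1\<close> and \<open>r - 2\<close> have \<open>2 - s\<close>; the larger
      value is the common index.\<close>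
    have j: "4 * (2 - s) = J 8"
      using oe(3) r by (simp add: J_def c_def)
    have h: "hindex False r = 2 - s - 1" "hindex True r = 2 - s - 1" "hindex False (r - 1) = 2 - s"
      "hindex True (r - 2) = 2 - s" "hindex False (r - 2) = 2 - s"
      unfolding hindex_def oe(3) by simp_all
    show ?thesis
    proof (rule main[OF j])
      show "H (hindex (\<not> p) r) (Suc d) = u *\<^sub>q H (2 - s) d + v1 (J 8) *\<^sub>q Y (2 - s)"
        "H (hindex p r) (Suc d) = u *\<^sub>q H (2 - s) d + v1 (J 8) *\<^sub>q Y (2 - s)"
        using oe(1) H1[OF j] by (simp_all only: h not_False_eq_True simp_thms)
    qed (use oe(1,2) recursion_linear_odd_even[OF c, of "int a" "int b" m] in \<open>simp_all add: h V_unfold\<close>)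
  next
    case (oo s)
    have j: "4 * (1 - s) = J 6"
      using oo(3) r by (simp add: J_def c_def)
    have h: "hindex False r = 1 - s" "hindex True r = 1 - s - 1" "hindex False (r - 1) = 1 - s"
      "hindex True (r - 2) = 1 - s"
      unfolding hindex_def oo(3) by simp_all
    show ?thesis
    proof (rule main[OF j])
      show "H (hindex (\<not> p) r) (Suc d) = u *\<^sub>q H (1 - s) d + v1 (J 6) *\<^sub>q Y (1 - s)"
        "H (hindex p r) (Suc d) = u *\<^sub>q H (1 - s) d + v0 (J 6) *\<^sub>q Y (1 - s)"
        using oo(1) H0[OF j] H1[OF j] by (simp_all only: h not_False_eq_True simp_thms)
    qed (use oo(1,2) recursion_linear_odd_odd[OF c, of "int a" "int b" m] in \<open>simp_all add: h V_unfold\<close>)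
  qed
qed

lemma component_summand_recursion_0:
  fixes a b :: nat and m r :: int and p :: bool
  assumes r: "r = int a + int b"
  defines "h \<equiv> \<lambda>\<alpha>. hbinom \<alpha> 0 * Kpow (- m)"
  shows "(qint (r + m) * coef \<zeta> (\<not> p) (int a) (int b) 0 m) *\<^sub>q
       normal_term \<zeta> a (h (hindex (\<not> p) r)) b =
     (qint m * (coef \<zeta> p (int a) (int b) 0 (m - 1) * q powi (- 2 * int a))) *\<^sub>q
       normal_term \<zeta> a (h (hindex p r)) b
   + (coef \<zeta> p (int a - 1) (int b) 0 m * qint (int a)) *\<^sub>q
       normal_term \<zeta> a (h (hindex p (r - 1))) b
   + (coef \<zeta> p (int a) (int b - 1) 0 m * q powi (- 2 * m - 2 * int a) * qint (int b)) *\<^sub>q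
       normal_term \<zeta> a (h (hindex p (r - 1) - 1)) b"
proof -
  have "coef \<zeta> (\<not> p) (int a) (int b) 0 m = coef \<zeta> p (int a) (int b) 0 m"
    by (simp add: coef_def weight_def)
  then show ?thesis
    unfolding coef_shift r recursion_c_0 h_def hbinom_0
    by (simp add: algebra_simps flip: scaleq_add_left)
qed

text \<open>Compares the second factors at the \<open>m\<close>-th divided power when
  \<open>Bgen_idivpow1\<close> for index \<open>r + m - 1\<close> is solved for its upward part and
  the coproduct applied. With all sums brought to \<open>triples r\<close>, the identity holds
  summand by summand.\<close>

lemma component_recursion:
  assumes p: "p \<longleftrightarrow> even (r + m - 1)"
  shows "qint (r + m) *\<^sub>q component \<zeta> (\<not> p) r m =
     qint m *\<^sub>q (Kpow (- 1) * component \<zeta> p r (m - 1))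
   + Bgen \<zeta> * component \<zeta> p (r - 1) m
   + (q * \<zeta> * (if even m then qint (m + 1) else 0)) *\<^sub>q
       (Kpow (- 1) * component \<zeta> p (r - 2) (m + 1))
   - (q * \<zeta> * (if p then 0 else qint (r + m - 1))) *\<^sub>q component \<zeta> True (r - 2) m"
proof -
  have K: "- (m - 1) - 1 = - m" by simp
  have B: "Bgen \<zeta> * component \<zeta> p (r - 1) m
      = Echeck \<zeta> * component \<zeta> p (r - 1) m + uF * component \<zeta> p (r - 1) m"
    by (simp add: Bgen_def distrib_right add.commute)
  show ?thesis
    unfolding B Echeck_component uF_component Kpow_component
    unfolding component_def K sum_triples_shift_right scaleq_sum_right
      sum.distrib[symmetric] sum_subtractf[symmetric]
  proof (intro sum.cong refl, clarify)
    fix a b c assume "(a, b, c) \<in> triples r"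
    then have abc: "r = int a + int b + 2 * int c" by (simp add: triples_def)
    show "qint (r + m) *\<^sub>q coef \<zeta> (\<not> p) (int a) (int b) c m *\<^sub>q
        normal_term \<zeta> a (hbinom (hindex (\<not> p) r) c * Kpow (- m)) b =
      qint m *\<^sub>q (coef \<zeta> p (int a) (int b) c (m - 1) * q powi (- 2 * int a)) *\<^sub>q
        normal_term \<zeta> a (hbinom (hindex p r) c * Kpow (- m)) b
    + ((coef \<zeta> p (int a - 1) (int b) c m * qint (int a)) *\<^sub>q
        normal_term \<zeta> a (hbinom (hindex p (r - 1)) c * Kpow (- m)) b
      + ((coef \<zeta> p (int a) (int b - 1) c m * q powi (- 2 * m - 2 * int a) * qint (int b)) *\<^sub>q
          normal_term \<zeta> a (hbinom (hindex p (r - 1) - 1) c * Kpow (- m)) b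
        + (case c of 0 \<Rightarrow> 0
          | Suc d \<Rightarrow> (coef \<zeta> p (int a + 1) (int b) d m * (q * \<zeta> / (q ^ 2 - 1))) *\<^sub>q
              normal_term \<zeta> a (hbinom (hindex p (r - 1)) d
                * (q powi (- 3 * int a) *\<^sub>q Kpow (- 2) - q powi (- int a) *\<^sub>q 1) * Kpow (- m)) b)))
    + (q * \<zeta> * (if even m then qint (m + 1) else 0)) *\<^sub>q
        (case c of 0 \<Rightarrow> 0
        | Suc d \<Rightarrow> (coef \<zeta> p (int a) (int b) d (m + 1) * q powi (- 2 * int a)) *\<^sub>q
            normal_term \<zeta> a (hbinom (hindex p (r - 2)) d * Kpow (- (m + 1) - 1)) b)
    - (q * \<zeta> * (if p then 0 else qint (r + m - 1))) *\<^sub>q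
        (case c of 0 \<Rightarrow> 0
        | Suc d \<Rightarrow> coef \<zeta> True (int a) (int b) d m *\<^sub>q
            normal_term \<zeta> a (hbinom (hindex True (r - 2)) d * Kpow (- m)) b)"
    proof (cases c)
      case 0
      then have "r = int a + int b" using abc by simp
      from component_summand_recursion_0[OF this, of m \<zeta> p] show ?thesis
        by (simp only: 0 nat.case scaleq_scaleq scaleq_zero_right add_0_right diff_zero add.assoc)
    next
      case (Suc d)
      then have "r = int a + int b + 2 * (int d + 1)" using abc by simp
      from component_summand_recursion_Suc[OF this p, of \<zeta>] show ?thesis
        by (simp only: Suc nat.case scaleq_scaleq add.assoc)
    qed
  qed
qed

section \<open>Divided powers and their coproducts\<close>

lemma Bgen_idivpow1:
  "Bgen \<zeta> * idivpow1 \<zeta> k = qint (int k + 1) *\<^sub>q idivpow1 \<zeta> (Suc k)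
     + (if odd k then q * \<zeta> * qint (int k) else 0) *\<^sub>q idivpow1 \<zeta> (k - 1)"
proof -
  let ?B = "Bgen \<zeta>"
  \<comment> \<open>The product shared by the indices \<open>2 * i\<close> and
    \<open>2 * i + 1\<close>; for even \<open>k\<close>, multiplication by \<open>?B\<close> passes
    from one to the other up to a scalar.\<close>
  define P where "P i = (\<Prod>j\<leftarrow>[1..<i + 1]. ?B ^ 2 - (q * \<zeta> * qint (2 * int j - 1) ^ 2) *\<^sub>q 1)" for i
  have even: "idivpow1 \<zeta> (2 * i) = (1 / qfact (2 * i)) *\<^sub>q P i" for i
    by (simp add: idivpow1_def P_def)
  have odd: "idivpow1 \<zeta> (Suc (2 * i)) = (1 / qfact (Suc (2 * i))) *\<^sub>q (?B * P i)" for i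
    by (simp add: idivpow1_def P_def)
  have P_Suc: "P (Suc i) = P i * (?B ^ 2 - (q * \<zeta> * qint (2 * int i + 1) ^ 2) *\<^sub>q 1)" for i
    by (simp add: P_def algebra_simps)
  have comm: "?B ^ 2 * P i = P i * ?B ^ 2" for i
  proof (induction i)
    case (Suc i)
    have "?B ^ 2 * P (Suc i) = P i * (?B ^ 2 * (?B ^ 2 - (q * \<zeta> * qint (2 * int i + 1) ^ 2) *\<^sub>q 1))"
      by (simp add: P_Suc Suc flip: mult.assoc)
    then show ?case
      by (simp add: P_Suc mult.assoc left_diff_distrib right_diff_distrib scaleq_simps)
  qed (simp add: P_def)
  \<comment> \<open>For odd \<open>k\<close>, completing the next factor of the product leaves a
    correction by the lower divided power; one of its two quantum integers is absorbed by
    \<open>qfact k\<close>.\<close>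
  have BBP: "?B * (?B * P i) = P (Suc i) + (q * \<zeta> * qint (2 * int i + 1) ^ 2) *\<^sub>q P i" for i
    using comm[of i]
    by (simp add: P_Suc right_diff_distrib scaleq_simps power2_eq_square mult.assoc)
  show ?thesis
  proof (cases "even k")
    case True
    then obtain i where k: "k = 2 * i" by (elim evenE)
    show ?thesis
      by (simp add: k even odd scaleq_simps qfact_Suc qfact_nonzero qint_eq_0_iff add.commute)
  next
    case False
    then obtain i where k: "k = Suc (2 * i)" by (auto elim: oddE)
    have "Suc k = 2 * Suc i" by (simp add: k)
    then have "idivpow1 \<zeta> (Suc k) = (1 / (qfact k * qint (int k + 1))) *\<^sub>q P (Suc i)"
      by (simp only: even) (simp add: k qfact_Suc add.commute)
    moreover have "qfact k = qfact (2 * i) * qint (2 * int i + 1)"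
      by (simp add: k qfact_Suc add.commute)
    moreover have "qint (2 * int i + 1) \<noteq> 0" "qint (int k + 1) \<noteq> 0" "int k = 2 * int i + 1"
      by (simp_all add: k qint_eq_0_iff)
    ultimately show ?thesis
      using False
      by (simp add: odd[of i, folded k] scaleq_simps BBP power2_eq_square)
        (simp add: k even scaleq_simps mult.assoc)
  qed
qed

text \<open>Strong induction, since index \<open>Suc k\<close> is reached from \<open>k\<close> and
  \<open>k - 1\<close>. Summing over the index of the first factor makes \<open>n - m\<close> the
  degree of the second.\<close>

lemma comult_idivpow1:
  "comult (idivpow1 \<zeta> n) =
     (\<Sum>m\<le>n. idivpow1 \<zeta> m \<otimes> component \<zeta> (even n) (int n - int m) (int m))"
proof (induction n rule: less_induct)
  case (less n)
  show ?case
  proof (cases n)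
    case 0
    have "triples 0 = {(0, 0, 0)}" by (auto simp: triples_def)
    then have "component \<zeta> True 0 0 = 1"
      by (simp add: component_def coef_def weight_def normal_term_def divpow_0 hbinom_0 Kpow_0 scaleq_one)
    moreover have "idivpow1 \<zeta> 0 = 1"
      by (simp add: idivpow1_def qfact_def scaleq_one)
    ultimately show ?thesis by (simp add: 0 comult_hom tensor_one)
  next
    case (Suc k)
    let ?b = "idivpow1 \<zeta>" and ?p = "even k"
    let ?C = "\<lambda>p n m. component \<zeta> p (n - m) m"
    \<comment> \<open>Components of negative degree vanish, so the sums in \<open>S2\<close>,
      \<open>S3\<close> and \<open>S4\<close> can be extended to a common range.\<close>
    have extend: "(\<Sum>m\<le>k. f m) = (\<Sum>m\<le>l. f m)" if "\<And>m. m > k \<Longrightarrow> f m = 0" "k \<le> l"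
      for f :: "nat \<Rightarrow> (uq, uq) tensor" and k l
      using that by (intro sum.mono_neutral_left) auto
    have IH: "comult (?b k) = (\<Sum>m\<le>k. ?b m \<otimes> ?C ?p (int k) (int m))"
      using less Suc by simp
    \<comment> \<open>The index moves up by one; the new summand at \<open>m = 0\<close> carries the
      factor \<open>qint 0\<close>.\<close>
    have S1: "(\<Sum>m\<le>k. (qint (int m + 1) *\<^sub>q ?b (Suc m))
          \<otimes> (Kpow (- 1) * ?C ?p (int k) (int m)))
        = (\<Sum>m\<le>Suc k. ?b m \<otimes> (qint (int m) *\<^sub>q
            (Kpow (- 1) * component \<zeta> ?p (int k + 1 - int m) (int m - 1))))"
      unfolding sum.atMost_Suc_shift
      by (simp add: qint_0 scaleq_zero_left tensor_zero_right tensor_scale_left tensor_scale_right add.commute)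
    have S2: "(\<Sum>m\<le>k. ((if odd m then q * \<zeta> * qint (int m) else 0) *\<^sub>q ?b (m - 1))
          \<otimes> (Kpow (- 1) * ?C ?p (int k) (int m)))
        = (\<Sum>m\<le>Suc k. ?b m \<otimes> ((q * \<zeta> * (if even (int m) then qint (int m + 1) else 0)) *\<^sub>q
             (Kpow (- 1) * component \<zeta> ?p (int k + 1 - int m - 2) (int m + 1))))" (is "sum ?f _ = _")
    proof -
      have "sum ?f {..k} = sum ?f {..Suc (Suc k)}"
        by (rule extend) (simp_all add: component_negative tensor_zero_right)
      \<comment> \<open>The summand dropped at index 0 is zero because 0 is not odd.\<close>
      also have "\<dots> = (\<Sum>m\<le>Suc k. ?f (Suc m))"
        unfolding sum.atMost_Suc_shift[of _ "Suc k"] by (simp add: scaleq_zero_left tensor_zero_left)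
      also have "\<dots> = (\<Sum>m\<le>Suc k. ?b m \<otimes> ((q * \<zeta> * (if even (int m) then qint (int m + 1) else 0)) *\<^sub>q
             (Kpow (- 1) * component \<zeta> ?p (int k + 1 - int m - 2) (int m + 1))))"
      proof (intro sum.cong refl)
        fix m
        have "int k - int (Suc m) = int k + 1 - int m - 2" "int (Suc m) = int m + 1" by simp_all
        then show "?f (Suc m) = ?b m \<otimes> ((q * \<zeta> * (if even (int m) then qint (int m + 1) else 0)) *\<^sub>q
             (Kpow (- 1) * component \<zeta> ?p (int k + 1 - int m - 2) (int m + 1)))"
          by (simp only: tensor_scale_left tensor_scale_right) simp
      qed
      finally show ?thesis .
    qed
    have S3: "(\<Sum>m\<le>k. ?b m \<otimes> (Bgen \<zeta> * ?C ?p (int k) (int m)))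
        = (\<Sum>m\<le>Suc k. ?b m \<otimes> (Bgen \<zeta> * component \<zeta> ?p (int k + 1 - int m - 1) (int m)))"
      by (subst extend[of _ _ "Suc k"]) (simp_all add: component_negative tensor_zero_right)
    have S4: "(if odd k then q * \<zeta> * qint (int k) else 0) *\<^sub>q comult (?b (k - 1))
        = (\<Sum>m\<le>Suc k. ?b m \<otimes> ((q * \<zeta> * (if ?p then 0 else qint (int k + 1 - int m + int m - 1))) *\<^sub>q
            component \<zeta> True (int k + 1 - int m - 2) (int m)))"
    proof (cases "odd k")
      case True
      then have "comult (?b (k - 1)) = (\<Sum>m\<le>k - 1. ?b m \<otimes> ?C True (int (k - 1)) (int m))"
        using less Suc by simp
      also have "\<dots> = (\<Sum>m\<le>Suc k. ?b m \<otimes> ?C True (int (k - 1)) (int m))"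
        by (rule extend) (auto simp: component_negative tensor_zero_right)
      finally show ?thesis
        using True odd_pos[OF True]
        by (simp add: scaleq_sum_right scaleq_add_right tensor_scale_right of_nat_diff algebra_simps)
    qed (simp add: scaleq_zero_left tensor_zero_right)
    have "comult (Bgen \<zeta> * ?b k)
        = (\<Sum>m\<le>k. (Bgen \<zeta> * ?b m) \<otimes> (Kpow (- 1) * ?C ?p (int k) (int m))
            + ?b m \<otimes> (Bgen \<zeta> * ?C ?p (int k) (int m)))"
      by (simp add: comult_hom comult_Bgen IH distrib_right sum_distrib_left sum.distrib tensor_mult)
    also have "\<dots> = (\<Sum>m\<le>k. (qint (int m + 1) *\<^sub>q ?b (Suc m))
          \<otimes> (Kpow (- 1) * ?C ?p (int k) (int m)))
        + (\<Sum>m\<le>k. ((if odd m then q * \<zeta> * qint (int m) else 0) *\<^sub>q ?b (m - 1))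
          \<otimes> (Kpow (- 1) * ?C ?p (int k) (int m)))
        + (\<Sum>m\<le>k. ?b m \<otimes> (Bgen \<zeta> * ?C ?p (int k) (int m)))"
      unfolding Bgen_idivpow1 tensor_add_left sum.distrib ..
    finally have eq: "comult (Bgen \<zeta> * ?b k)
        - (if odd k then q * \<zeta> * qint (int k) else 0) *\<^sub>q comult (?b (k - 1))
      = (\<Sum>m\<le>Suc k. ?b m \<otimes> (qint (int k + 1 - int m + int m) *\<^sub>q
          component \<zeta> (\<not> ?p) (int k + 1 - int m) (int m)))"
      unfolding S1 S2 S3 S4
      by (subst component_recursion)
        (simp_all only: tensor_add_right tensor_diff_right sum.distrib sum_subtractf, simp_all)
    have "comult (Bgen \<zeta> * ?b k)
        - (if odd k then q * \<zeta> * qint (int k) else 0) *\<^sub>q comult (?b (k - 1))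
       = qint (int k + 1) *\<^sub>q comult (?b (Suc k))"
      by (simp add: Bgen_idivpow1 comult_hom)
    with eq have "qint (int k + 1) *\<^sub>q comult (?b (Suc k))
       = qint (int k + 1) *\<^sub>q (\<Sum>m\<le>Suc k. ?b m
          \<otimes> component \<zeta> (even (Suc k)) (int (Suc k) - int m) (int m))"
      by (simp add: scaleq_sum_right scaleq_add_right tensor_scale_right add.commute)
    moreover have "qint (int k + 1) \<noteq> 0" by (simp add: qint_eq_0_iff)
    ultimately show ?thesis unfolding Suc by (rule scaleq_cancel[rotated])
  qed
qed

section \<open>Passage to the double sums of the theorem\<close>

lemma component_eq_double_sum:
  "component \<zeta> p (int r) m = (\<Sum>c = 0..r div 2. \<Sum>a = 0..r - 2 * c.
     (q powi (weight p c - (int r - 2 * int c) * m - int a * (int r - 2 * int c - int a))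
        * (q * \<zeta>) ^ c) *\<^sub>q
     (divpow (Echeck \<zeta>) a * hbinom (hindex p (int r)) c * Kpow (- m) * divpow uF (r - 2 * c - a)))"
proof -
  let ?f = "\<lambda>a b c. coef \<zeta> p (int a) (int b) c m *\<^sub>q
      normal_term \<zeta> a (hbinom (hindex p (int r)) c * Kpow (- m)) b"
  \<comment> \<open>A triple of degree \<open>r\<close> is determined by \<open>c\<close> and
    \<open>a\<close>; the truncated subtraction giving \<open>b\<close> is exact within the
    summation bounds.\<close>
  have "component \<zeta> p (int r) m =
      (\<Sum>(c, a)\<in>Sigma {0..r div 2} (\<lambda>c. {0..r - 2 * c}). ?f a (r - 2 * c - a) c)"
    unfolding component_def
  proof (rule sum.reindex_bij_witness[where i = "\<lambda>(c, a). (a, r - 2 * c - a, c)"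
        and j = "\<lambda>(a, b, c). (c, a)"])
    fix x assume x: "x \<in> triples (int r)"
    obtain a b c where abc: "x = (a, b, c)" by (cases x)
    have "b = r - 2 * c - a" using x by (simp add: triples_def abc)
    then show "(case (case x of (a, b, c) \<Rightarrow> (c, a)) of (c, a) \<Rightarrow> ?f a (r - 2 * c - a) c)
        = (case x of (a, b, c) \<Rightarrow> ?f a b c)"
      by (simp only: abc prod.case)
  qed (auto simp: triples_def)
  also have "\<dots> = (\<Sum>c = 0..r div 2. \<Sum>a = 0..r - 2 * c. ?f a (r - 2 * c - a) c)"
    by (rule sum.Sigma[symmetric]) auto
  also have "\<dots> = (\<Sum>c = 0..r div 2. \<Sum>a = 0..r - 2 * c.
     (q powi (weight p c - (int r - 2 * int c) * m - int a * (int r - 2 * int c - int a))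
        * (q * \<zeta>) ^ c) *\<^sub>q
     (divpow (Echeck \<zeta>) a * hbinom (hindex p (int r)) c * Kpow (- m) * divpow uF (r - 2 * c - a)))"
  proof (intro sum.cong refl)
    fix c a assume "c \<in> {0..r div 2}" "a \<in> {0..r - 2 * c}"
    then have "int (r - 2 * c - a) = int r - 2 * int c - int a" by auto
    then show "?f a (r - 2 * c - a) c =
     (q powi (weight p c - (int r - 2 * int c) * m - int a * (int r - 2 * int c - int a))
        * (q * \<zeta>) ^ c) *\<^sub>q
     (divpow (Echeck \<zeta>) a * hbinom (hindex p (int r)) c * Kpow (- m) * divpow uF (r - 2 * c - a))"
      by (simp add: coef_def normal_term_def mult.assoc)
  qed
  finally show ?thesis .
qed

lemma weight_choose:
  "weight True c = int ((2 * c + 1) choose 2)" "weight False c = int ((2 * c) choose 2)"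
  by (cases c; simp add: weight_def choose_two algebra_simps zdiv_int)+

theorem theorem5p1:
  fixes \<zeta> :: ratfun and n :: nat
  assumes "\<zeta> \<noteq> 0"
  shows
    "(even n \<longrightarrow> comult (idivpow1 \<zeta> n) =
       (\<Sum>r = 0..n. idivpow1 \<zeta> (n - r) \<otimes>
         (\<Sum>c = 0..r div 2. \<Sum>a = 0..r - 2 * c.
           (q powi (int ((2 * c + 1) choose 2)
                 + (int r - 2 * int c) * (int r - int n)
                 - int a * (int r - 2 * int c - int a))
             * (q * \<zeta>) ^ c) *\<^sub>q
           (divpow (Echeck \<zeta>) a * hbinom (- ((int r - 1) div 2)) c
             * Kpow (int r - int n) * divpow uF (r - 2 * c - a)))))
   \<and> (odd n \<longrightarrow> comult (idivpow1 \<zeta> n) =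
       (\<Sum>r = 0..n. idivpow1 \<zeta> (n - r) \<otimes>
         (\<Sum>c = 0..r div 2. \<Sum>a = 0..r - 2 * c.
           (q powi (int ((2 * c) choose 2)
                 + (int r - 2 * int c) * (int r - int n)
                 - int a * (int r - 2 * int c - int a))
             * (q * \<zeta>) ^ c) *\<^sub>q
           (divpow (Echeck \<zeta>) a * hbinom (- ((int r - 2) div 2)) c
             * Kpow (int r - int n) * divpow uF (r - 2 * c - a)))))"
proof -
  \<comment> \<open>The sum is reversed: \<open>r\<close> is \<open>n\<close> minus the index of the
    first factor.\<close>
  have "comult (idivpow1 \<zeta> n) = (\<Sum>r = 0..n. idivpow1 \<zeta> (n - r) \<otimes>
      component \<zeta> (even n) (int n - int (n - r)) (int (n - r)))"
    unfolding comult_idivpow1 atMost_atLeast0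
    by (subst sum.atLeastAtMost_rev) simp
  also have "\<dots> = (\<Sum>r = 0..n. idivpow1 \<zeta> (n - r) \<otimes> component \<zeta> (even n) (int r) (int n - int r))"
    by (intro sum.cong refl) (simp add: of_nat_diff)
  finally have *: "comult (idivpow1 \<zeta> n) =
      (\<Sum>r = 0..n. idivpow1 \<zeta> (n - r) \<otimes> component \<zeta> (even n) (int r) (int n - int r))" .
  have neg: "i - j * (int n - int r) - l = i + j * (int r - int n) - l"
    "- (int n - int r) = int r - int n" for i j l r
    by (simp_all add: algebra_simps)
  show ?thesis
    unfolding * component_eq_double_sum neg
    by (cases "even n") (simp_all only: weight_choose hindex_def if_True if_False simp_thms)
qed

end
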